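(* Let $T>0$ and let $H:[0,T]\times\mathbb{R}^n\times\mathbb{R}^n\to\mathbb{R}$ satisfy (H1)–(H4) and (HLC) (as described in the context), with functions $c(\cdot)$ and $k_R(\cdot)$ as there. Then there exist functions $f:[0,T]\times\mathbb{R}^n\times\mathbb{R}^{n+1}\to\mathbb{R}^n$ and $l:[0,T]\times\mathbb{R}^n\times\mathbb{R}^{n+1}\to\mathbb{R}$, Lebesgue measurable in $t$ for every $(x,a)\in\mathbb{R}^n\times\mathbb{R}^{n+1}$ and continuous in $(x,a)$ for every $t\in[0,T]$, such that for every $t\in[0,T]$ and $x,p\in\mathbb{R}^n$ $$H(t,x,p)=\sup_{a\in\mathbb{R}^{n+1}}\{\langle p,f(t,x,a)\rangle-l(t,x,a)\}$$ and $f(t,x,\mathbb{R}^{n+1})=\mathrm{dom}\,H^*(t,x,\cdot)$. Moreover: (A1) for every $R>0$, $t\in[0,T]$, $x,y\in \bar B_R$, $a,b\in\mathbb{R}^{n+1}$, $|f(t,x,a)-f(t,y,b)|\le 10(n+1)(k_R(t)|x-y|+|a-b|)$ and $|l(t,x,a)-l(t,y,b)|\le 10(n+1)(k_R(t)|x-y|+|a-b|)$; (A2) for every $t\in[0,T]$, $x\in\mathbb{R}^n$, $a\in\mathbb{R}^{n+1}$: $|f(t,x,a)|\le c(t)(1+|x|)$ and $-|H(t,x,0)|\le l(t,x,a)\le 2|H(t,x,0)|+2c(t)(1+|x|)+3|a|$; (A3) $a=(f(t,x,a),l(t,x,a))$ for all $a\in\mathrm{epi}\,H^*(t,x,\cdot)$,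 $t\in[0,T]$, $x\in\mathbb{R}^n$; (A4) if in addition $H$ is continuous (jointly in $(t,x,p)$), then $f$ and $l$ are continuous.
   Context: Hypotheses on $H:[0,T]\times\mathbb{R}^n\times\mathbb{R}^n\to\mathbb{R}$: (H1) $H(\cdot,x,p)$ is Lebesgue measurable for all $x,p$; (H2) $H(t,\cdot,\cdot)$ is continuous for every $t$; (H3) $H(t,x,\cdot)$ is convex for every $(t,x)$; (H4) there is a measurable $c:[0,T]\to[0,\infty)$ with $|H(t,x,p)-H(t,x,q)|\le c(t)(1+|x|)|p-q|$ for all $t,x,p,q$; (HLC) for every $R>0$ there is a measurable $k_R:[0,T]\to[0,\infty)$ with $|H(t,x,p)-H(t,y,p)|\le k_R(t)(1+|p|)|x-y|$ for all $t\in[0,T]$, $x,y\in\bar B_R$, $p\in\mathbb{R}^n$. Here $\bar B_R$ is the closed ball of radius $R$ centered at $0$. $H^*(t,x,v)=\sup_{p\in\mathbb{R}^n}\{\langle v,p\rangle-H(t,x,p)\}\in\mathbb{R}\cup\{+\infty\}$; $\mathrm{dom}\,\varphi=\{v:\varphi(v)<+\infty\}$ and $\mathrm{epi}\,\varphi=\{(v,r)\in\mathbb{R}^n\times\mathbb{R}:\varphi(v)\le r\}$. *)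

theory Defs
  imports "HOL-Analysis.Analysis"
begin

definition Hconj :: "(real \<Rightarrow> 'a::euclidean_space \<Rightarrow> 'a \<Rightarrow> real) \<Rightarrow> real \<Rightarrow> 'a \<Rightarrow> 'a \<Rightarrow> ereal" where
  "Hconj H t x v = (SUP p. ereal (inner v p - H t x p))"

definition Hconj_dom :: "(real \<Rightarrow> 'a::euclidean_space \<Rightarrow> 'a \<Rightarrow> real) \<Rightarrow> real \<Rightarrow> 'a \<Rightarrow> 'a set" where
  "Hconj_dom H t x = {v. Hconj H t x v < \<infinity>}"

definition Hconj_epi :: "(real \<Rightarrow> 'a::euclidean_space \<Rightarrow> 'a \<Rightarrow> real) \<Rightarrow> real \<Rightarrow> 'a \<Rightarrow> ('a \<times> real) set" where
  "Hconj_epi H t x = {(v, r). Hconj H t x v \<le> ereal r}"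

end

theory Submission
  imports Defs
begin

text \<open>The pair \<open>(f, l)\<close> is a Lipschitz retraction of \<open>\<real>\<^sup>n \<times> \<real>\<close> onto the epigraph \<open>E\<close> of \<open>H\<^sup>*(t, x, \<cdot>)\<close>:
  a point \<open>a\<close> is sent to the Steiner point of the compact convex set of those points of \<open>E\<close> whose distance
  to \<open>a\<close> is at most twice the distance from \<open>a\<close> to \<open>E\<close>. This set depends in a Lipschitz way on \<open>a\<close> and, for the
  Hausdorff distance, on \<open>E\<close>, and the Steiner point is Lipschitz with the dimension as constant.
  The epigraphs of the conjugates are Hausdorff close when the convex functions are close, by separating
  a convex function from a cone lying below it. A localised form of these estimates shows that the
  retraction depends continuously on the convex function \<open>H(t, x, \<cdot>)\<close> for locally uniform convergence,
  which yields both joint continuity and, for the topology of pointwise convergence on a countable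
  dense set, measurability in \<open>t\<close>.\<close>

section \<open>Steiner points\<close>

definition supp_fun :: "'a::euclidean_space set \<Rightarrow> 'a \<Rightarrow> real" where
  "supp_fun K p = (SUP z\<in>K. inner p z)"

lemma supp_fun_upper:
  assumes "bounded K" "z \<in> K"
  shows "inner p z \<le> supp_fun K p"
  unfolding supp_fun_def
proof (rule cSUP_upper[OF assms(2)])
  obtain R where "\<And>z. z \<in> K \<Longrightarrow> norm z \<le> R"
    using assms(1) by (auto simp: bounded_iff)
  then have "inner p z \<le> norm p * R" if "z \<in> K" for z
    by (meson norm_cauchy_schwarz mult_left_mono norm_ge_zero order_trans that)
  then show "bdd_above (inner p ` K)"
    by (auto simp: bdd_above_def)
qed

lemma supp_fun_least:
  assumes "K \<noteq> {}" "\<And>z. z \<in> K \<Longrightarrow> inner p z \<le> r"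
  shows "supp_fun K p \<le> r"
  unfolding supp_fun_def using assms by (intro cSUP_least) auto

lemma supp_fun_sublinear:
  assumes "bounded K" "K \<noteq> {}" "\<epsilon> \<ge> 0"
  shows "supp_fun K (p + \<epsilon> *\<^sub>R q) \<le> supp_fun K p + \<epsilon> * supp_fun K q"
  using assms
  by (intro supp_fun_least) (auto simp: inner_add_left intro!: add_mono mult_left_mono supp_fun_upper)

text \<open>The error is homogeneous in \<open>p\<close>. Applied in both directions, this turns a
  Hausdorff bound between two sets into a bound on the difference of their support
  functions.\<close>

lemma supp_fun_le_of_near:
  assumes "K \<noteq> {}" "bounded L" "\<And>z. z \<in> K \<Longrightarrow> \<exists>z'\<in>L. norm (z - z') \<le> D"
  shows "supp_fun K p \<le> supp_fun L p + D * norm p"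
proof (rule supp_fun_least[OF assms(1)])
  fix z assume "z \<in> K"
  then obtain z' where z': "z' \<in> L" "norm (z - z') \<le> D"
    using assms(3) by blast
  have "inner p z = inner p z' + inner p (z - z')"
    by (simp add: inner_diff_right)
  also have "\<dots> \<le> supp_fun L p + norm p * D"
    using supp_fun_upper[OF assms(2) z'(1)] norm_cauchy_schwarz[of p "z - z'"] z'(2)
    by (meson add_mono mult_left_mono norm_ge_zero order_trans)
  finally show "inner p z \<le> supp_fun L p + D * norm p"
    by (simp add: mult.commute)
qed

lemma continuous_on_supp_fun:
  assumes "bounded K" "K \<noteq> {}"
  shows "continuous_on UNIV (supp_fun K)"
proof -
  obtain R where R: "R > 0" "\<And>z. z \<in> K \<Longrightarrow> norm z \<le> R"
    using assms(1) by (auto simp: bounded_pos)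
  have le: "supp_fun K p \<le> supp_fun K q + R * norm (p - q)" for p q
  proof (rule supp_fun_least[OF assms(2)])
    fix z assume z: "z \<in> K"
    have "inner p z = inner q z + inner (p - q) z"
      by (simp add: inner_diff_left)
    also have "\<dots> \<le> supp_fun K q + norm (p - q) * R"
      using supp_fun_upper[OF assms(1) z] norm_cauchy_schwarz[of "p - q" z] R(2)[OF z]
      by (meson add_mono mult_left_mono norm_ge_zero order_trans)
    finally show "inner p z \<le> supp_fun K q + R * norm (p - q)"
      by (simp add: mult.commute)
  qed
  have "dist (supp_fun K p) (supp_fun K q) \<le> R * dist p q" for p q
    using le[of p q] le[of q p] by (simp add: dist_norm norm_minus_commute)
  then have "R-lipschitz_on UNIV (supp_fun K)"
    using R(1) by (intro lipschitz_onI) auto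
  then show ?thesis
    by (rule lipschitz_on_continuous_on)
qed

text \<open>\<open>bump_slope\<close> is minus the gradient of \<open>bump\<close>. Integrating the support function against it gives the average
  of the gradient of the support function with weight \<open>bump\<close>, hence a point of the set; the classical
  Steiner point is the same average with uniform weight on the unit ball.\<close>

definition bump :: "'a::euclidean_space \<Rightarrow> real" where
  "bump p = (max 0 (1 - inner p p))\<^sup>2"

definition bump_slope :: "'a::euclidean_space \<Rightarrow> 'a" where
  "bump_slope p = (4 * max 0 (1 - inner p p)) *\<^sub>R p"

definition bump_mass :: "'a::euclidean_space itself \<Rightarrow> real" where
  "bump_mass _ = (\<integral>p. bump (p::'a) \<partial>lborel)"

definition steiner :: "'a::euclidean_space set \<Rightarrow> 'a" where
  "steiner K = (1 / bump_mass TYPE('a)) *\<^sub>R (\<integral>p. supp_fun K p *\<^sub>R bump_slope p \<partial>lborel)"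

section \<open>Integrals of the bump function and of its gradient\<close>

lemma integrable_continuous_compact_support:
  fixes f :: "'a::euclidean_space \<Rightarrow> 'b::{banach, second_countable_topology}"
  assumes "continuous_on UNIV f" "\<And>x. norm x > r \<Longrightarrow> f x = 0"
  shows "integrable lborel f"
proof -
  have "integrable lborel (\<lambda>x. indicator (cball 0 r) x *\<^sub>R f x)"
    using assms(1) by (intro borel_integrable_compact) (auto intro: continuous_on_subset)
  moreover have "(\<lambda>x. indicator (cball 0 r) x *\<^sub>R f x) = f"
    using assms(2) by (auto simp: indicator_def not_le)
  ultimately show ?thesis by simp
qed

lemma lborel_integral_shift:
  fixes f :: "'a::euclidean_space \<Rightarrow> real"
  assumes "continuous_on UNIV f"
  shows "(\<integral>p. f (c + p) \<partial>lborel) = (\<integral>p. f p \<partial>lborel)"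
proof -
  have "(\<integral>p. f p \<partial>lborel) = (\<integral>p. f p \<partial>distr lborel borel ((+) c))"
    by (simp add: lborel_distr_plus)
  also have "\<dots> = (\<integral>p. f (c + p) \<partial>lborel)"
    using assms by (subst integral_distr) (auto intro: borel_measurable_continuous_onI)
  finally show ?thesis ..
qed

text \<open>The squared positive part has a Lipschitz derivative, so its first-order Taylor
  remainder is quadratic even across the kink. This regularity is the reason for the square in
  \<open>bump\<close>.\<close>

lemma max_zero_square_expansion:
  fixes u h :: real
  shows "\<bar>(max 0 (u + h))\<^sup>2 - (max 0 u)\<^sup>2 - 2 * max 0 u * h\<bar> \<le> h\<^sup>2"
proof -
  consider "0 \<le> u" "0 \<le> u + h" | "0 \<le> u" "u + h \<le> 0" | "u \<le> 0" "0 \<le> u + h" | "u \<le> 0" "u + h \<le> 0"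
    by linarith
  then show ?thesis
  proof cases
    case 1
    then have "(max 0 (u + h))\<^sup>2 - (max 0 u)\<^sup>2 - 2 * max 0 u * h = h\<^sup>2"
      by (simp add: power2_eq_square algebra_simps)
    then show ?thesis by simp
  next
    case 2
    then have "(max 0 (u + h))\<^sup>2 - (max 0 u)\<^sup>2 - 2 * max 0 u * h = - (u\<^sup>2) - 2 * u * h"
      by simp
    moreover have "- (u\<^sup>2) - 2 * u * h \<le> h\<^sup>2"
      using zero_le_power2[of "u + h"] by (simp add: power2_sum)
    moreover have "u * (u + h) \<le> 0" "u * h \<le> 0"
      using 2 by (auto simp: mult_nonneg_nonpos)
    then have "u\<^sup>2 + 2 * u * h \<le> h\<^sup>2"
      using zero_le_power2[of h] unfolding power2_eq_square distrib_left by linarith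
    ultimately show ?thesis by linarith
  next
    case 3
    then have "(u + h)\<^sup>2 \<le> h\<^sup>2" by (intro power_mono) auto
    then show ?thesis using 3 by simp
  next
    case 4
    then show ?thesis by simp
  qed
qed

lemma continuous_on_bump: "continuous_on UNIV (bump :: 'a::euclidean_space \<Rightarrow> real)"
  unfolding bump_def by (intro continuous_intros)

lemma continuous_on_bump_slope: "continuous_on UNIV (bump_slope :: 'a::euclidean_space \<Rightarrow> 'a)"
  unfolding bump_slope_def by (intro continuous_intros)

lemma inner_self_ge_one: "norm (p::'a::real_inner) \<ge> 1 \<Longrightarrow> 1 - inner p p \<le> 0"
  using power_mono[of 1 "norm p" 2] by (simp add: power2_norm_eq_inner)

lemma bump_eq_zero: "norm p \<ge> 1 \<Longrightarrow> bump p = 0"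
  using inner_self_ge_one[of p] by (simp add: bump_def)

lemma bump_slope_eq_zero: "norm p \<ge> 1 \<Longrightarrow> bump_slope p = 0"
  using inner_self_ge_one[of p] by (simp add: bump_slope_def)

lemma bump_nonneg: "bump p \<ge> 0"
  by (simp add: bump_def)

text \<open>If the integral vanished, \<open>bump\<close> would be zero almost everywhere, yet it is
  positive on the open unit ball, which has positive volume.\<close>

lemma bump_mass_pos: "bump_mass TYPE('a::euclidean_space) > 0"
proof -
  have int: "integrable lborel (bump :: 'a \<Rightarrow> real)"
    by (rule integrable_continuous_compact_support[of _ 1, OF continuous_on_bump])
       (simp add: bump_eq_zero)
  have "\<not> (AE p in lborel. bump (p::'a) = 0)"
  proof
    assume "AE p in lborel. bump (p::'a) = 0"
    moreover have "bump p \<noteq> 0" if "p \<in> ball 0 1" for p :: 'a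
    proof -
      have "inner p p < 1"
        using that by (simp add: norm_lt flip: power2_norm_eq_inner) (simp add: abs_square_less_1)
      then show ?thesis by (simp add: bump_def)
    qed
    ultimately have "AE p in lborel. p \<notin> ball (0::'a) 1"
      by (auto elim!: eventually_mono)
    then have "emeasure lborel (ball (0::'a) 1) = 0"
      by (subst (asm) AE_iff_measurable[OF _ refl]) (auto simp: ball_def)
    then show False
      using emeasure_lborel_ball_finite content_ball_pos[of 1 "0::'a"] by (simp add: measure_def)
  qed
  then have "(\<integral>p. bump (p::'a) \<partial>lborel) \<noteq> 0"
    using integral_nonneg_eq_0_iff_AE[OF int] by (simp add: bump_nonneg)
  moreover have "(\<integral>p. bump (p::'a) \<partial>lborel) \<ge> 0"
    by (intro integral_nonneg_AE) (simp add: bump_nonneg)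
  ultimately show ?thesis by (simp add: bump_mass_def)
qed

text \<open>First-order Taylor expansion of \<open>bump\<close>. The remainder is quadratic in
  \<epsilon>, uniformly in \<open>p\<close>, and lives in a fixed ball, so it stays quadratic after
  integration against any continuous function.\<close>

lemma bump_expansion:
  fixes p q :: "'a::euclidean_space"
  assumes "0 \<le> \<epsilon>" "\<epsilon> \<le> 1"
  shows "\<bar>bump (p - \<epsilon> *\<^sub>R q) - bump p - \<epsilon> * inner (bump_slope p) q\<bar>
           \<le> \<epsilon>\<^sup>2 * ((4 + 3 * norm q)\<^sup>2 * (norm q)\<^sup>2 + 2 * (norm q)\<^sup>2) * indicator (cball 0 (1 + norm q)) p"
proof (cases "norm p \<le> 1 + norm q")
  case False
  have "norm (\<epsilon> *\<^sub>R q) \<le> norm q"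
    using assms by (simp add: mult_left_le_one_le)
  then have "norm (p - \<epsilon> *\<^sub>R q) \<ge> 1" "norm p \<ge> 1"
    using False norm_triangle_ineq2[of p "\<epsilon> *\<^sub>R q"] norm_ge_zero[of q] by linarith+
  then show ?thesis
    by (simp add: bump_eq_zero bump_slope_eq_zero)
next
  case True
  define u where "u = 1 - inner p p"
  define h where "h = 2 * \<epsilon> * inner p q - \<epsilon>\<^sup>2 * inner q q"
  have eq: "1 - inner (p - \<epsilon> *\<^sub>R q) (p - \<epsilon> *\<^sub>R q) = u + h"
    by (simp add: u_def h_def inner_diff_left inner_diff_right inner_commute power2_eq_square)
  \<comment> \<open>There are two errors: \<open>A\<close> and \<open>B\<close> bound the one from
    linearising the squared positive part in \<open>h\<close>, and \<open>C\<close> the one from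
    dropping the part of \<open>h\<close> that is quadratic in \<epsilon>.\<close>
  have A: "\<bar>(max 0 (u + h))\<^sup>2 - (max 0 u)\<^sup>2 - 2 * max 0 u * h\<bar> \<le> h\<^sup>2"
    by (rule max_zero_square_expansion)
  have "\<bar>h\<bar> \<le> \<epsilon> * ((4 + 3 * norm q) * norm q)"
  proof -
    have "\<bar>inner p q\<bar> \<le> (1 + norm q) * norm q"
      using Cauchy_Schwarz_ineq2[of p q] mult_right_mono[OF True norm_ge_zero[of q]] by linarith
    then have "2 * \<epsilon> * \<bar>inner p q\<bar> \<le> 2 * \<epsilon> * ((1 + norm q) * norm q)"
      using assms by (intro mult_left_mono) auto
    moreover have "\<epsilon>\<^sup>2 * inner q q \<le> \<epsilon> * (norm q)\<^sup>2"
    proof -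
      have "\<epsilon>\<^sup>2 \<le> \<epsilon>" using assms by (simp add: power2_eq_square mult_left_le_one_le)
      then show ?thesis by (simp add: power2_norm_eq_inner mult_right_mono)
    qed
    moreover have "\<bar>h\<bar> \<le> 2 * \<epsilon> * \<bar>inner p q\<bar> + \<epsilon>\<^sup>2 * inner q q"
      using assms(1) abs_triangle_ineq4[of "2 * \<epsilon> * inner p q" "\<epsilon>\<^sup>2 * inner q q"]
      by (simp add: h_def abs_mult)
    ultimately have "\<bar>h\<bar> \<le> 2 * \<epsilon> * ((1 + norm q) * norm q) + \<epsilon> * (norm q)\<^sup>2"
      by linarith
    also have "\<dots> = \<epsilon> * ((2 + 3 * norm q) * norm q)"
      by (simp add: power2_eq_square algebra_simps)
    also have "\<dots> \<le> \<epsilon> * ((4 + 3 * norm q) * norm q)"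
      using assms by (intro mult_left_mono mult_right_mono) auto
    finally show ?thesis .
  qed
  then have B: "h\<^sup>2 \<le> \<epsilon>\<^sup>2 * ((4 + 3 * norm q)\<^sup>2 * (norm q)\<^sup>2)"
    using power_mono[of "\<bar>h\<bar>" "\<epsilon> * ((4 + 3 * norm q) * norm q)" 2]
    by (simp add: power_mult_distrib)
  have "max 0 u * inner q q \<le> 1 * inner q q"
    by (intro mult_right_mono) (auto simp: u_def)
  then have "2 * \<epsilon>\<^sup>2 * (max 0 u * inner q q) \<le> 2 * \<epsilon>\<^sup>2 * inner q q"
    by (intro mult_left_mono) auto
  moreover have "0 \<le> 2 * \<epsilon>\<^sup>2 * (max 0 u * inner q q)" by simp
  ultimately have C: "\<bar>2 * max 0 u * h - \<epsilon> * inner (bump_slope p) q\<bar> \<le> 2 * \<epsilon>\<^sup>2 * (norm q)\<^sup>2"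
    by (simp add: h_def bump_slope_def u_def[symmetric] power2_norm_eq_inner algebra_simps)
  have "\<bar>bump (p - \<epsilon> *\<^sub>R q) - bump p - \<epsilon> * inner (bump_slope p) q\<bar>
        \<le> \<epsilon>\<^sup>2 * ((4 + 3 * norm q)\<^sup>2 * (norm q)\<^sup>2) + 2 * \<epsilon>\<^sup>2 * (norm q)\<^sup>2"
    unfolding bump_def eq u_def[symmetric] using A B C by linarith
  then show ?thesis using True by (simp add: algebra_simps)
qed

text \<open>The idea is to compare \<open>\<integral> \<sigma>(p + \<epsilon> q) bump(p) dp \<le> \<integral> \<sigma>(p) bump(p) dp + \<epsilon> \<sigma>(q) bump_mass\<close> with the same
  integral after translation by \<open>\<epsilon> q\<close>, and to let \<open>\<epsilon>\<close> tend to \<open>0\<close>.\<close>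

lemma integral_sublinear_bump_slope_le:
  fixes \<sigma> :: "'a::euclidean_space \<Rightarrow> real"
  assumes cont: "continuous_on UNIV \<sigma>"
    and sub: "\<And>p q \<epsilon>. \<epsilon> \<ge> 0 \<Longrightarrow> \<sigma> (p + \<epsilon> *\<^sub>R q) \<le> \<sigma> p + \<epsilon> * \<sigma> q"
  shows "(\<integral>p. \<sigma> p * inner (bump_slope p) q \<partial>lborel) \<le> \<sigma> q * bump_mass TYPE('a)"
proof -
  define I where "I = (\<integral>p. \<sigma> p * inner (bump_slope p) q \<partial>lborel)"
  define C where "C = (4 + 3 * norm q)\<^sup>2 * (norm q)\<^sup>2 + 2 * (norm q)\<^sup>2"
  define J where "J = (\<integral>p. indicator (cball 0 (1 + norm q)) p *\<^sub>R \<bar>\<sigma> p\<bar> \<partial>lborel)"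
  have intJ: "integrable lborel (\<lambda>p. indicator (cball 0 (1 + norm q)) p *\<^sub>R \<bar>\<sigma> p\<bar>)"
    by (intro borel_integrable_compact compact_cball continuous_on_rabs continuous_on_subset[OF cont]) simp
  have int0: "integrable lborel (\<lambda>p. \<sigma> p * inner (bump_slope p) q)"
    by (rule integrable_continuous_compact_support[of _ 1])
       (auto intro!: continuous_intros cont continuous_on_bump_slope simp: bump_slope_eq_zero)
  have int1: "integrable lborel (\<lambda>p. \<sigma> p * bump p)"
    by (rule integrable_continuous_compact_support[of _ 1])
       (auto intro!: continuous_on_mult cont continuous_on_bump simp: bump_eq_zero)
  have int3: "integrable lborel (bump :: 'a \<Rightarrow> real)"
    by (rule integrable_continuous_compact_support[of _ 1, OF continuous_on_bump])
       (simp add: bump_eq_zero)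
  have step: "\<epsilon> * I \<le> \<epsilon> * (\<sigma> q * bump_mass TYPE('a)) + \<epsilon>\<^sup>2 * C * J" if e: "0 < \<epsilon>" "\<epsilon> \<le> 1" for \<epsilon>
  proof -
    have "continuous_on UNIV (\<lambda>p. bump (p - \<epsilon> *\<^sub>R q))"
      by (rule continuous_on_compose2[OF continuous_on_bump]) (auto intro: continuous_intros)
    then have cont2: "continuous_on UNIV (\<lambda>p. \<sigma> p * bump (p - \<epsilon> *\<^sub>R q))"
      by (rule continuous_on_mult[OF cont])
    have cont3: "continuous_on UNIV (\<lambda>p. \<sigma> (\<epsilon> *\<^sub>R q + p))"
      by (rule continuous_on_compose2[OF cont]) (auto intro: continuous_intros)
    have int2: "integrable lborel (\<lambda>p. \<sigma> p * bump (p - \<epsilon> *\<^sub>R q))"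
    proof (rule integrable_continuous_compact_support[of _ "1 + norm q", OF cont2])
      fix p :: 'a assume "1 + norm q < norm p"
      moreover have "norm (\<epsilon> *\<^sub>R q) \<le> norm q"
        using e by (simp add: mult_left_le_one_le)
      ultimately have "norm (p - \<epsilon> *\<^sub>R q) \<ge> 1"
        using norm_triangle_ineq2[of p "\<epsilon> *\<^sub>R q"] by linarith
      then show "\<sigma> p * bump (p - \<epsilon> *\<^sub>R q) = 0" by (simp add: bump_eq_zero)
    qed
    have int4: "integrable lborel (\<lambda>p. \<sigma> (\<epsilon> *\<^sub>R q + p) * bump p)"
      by (rule integrable_continuous_compact_support[of _ 1])
         (auto intro!: continuous_on_mult cont3 continuous_on_bump simp: bump_eq_zero)
    \<comment> \<open>The sign of \<sigma> is arbitrary, so the weighted Taylor remainder is bounded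
      below through its absolute value.\<close>
    have pt: "\<sigma> p * (bump (p - \<epsilon> *\<^sub>R q) - bump p - \<epsilon> * inner (bump_slope p) q)
         \<ge> - (\<epsilon>\<^sup>2 * C * (indicator (cball 0 (1 + norm q)) p *\<^sub>R \<bar>\<sigma> p\<bar>))" for p
    proof -
      have "\<bar>\<sigma> p * (bump (p - \<epsilon> *\<^sub>R q) - bump p - \<epsilon> * inner (bump_slope p) q)\<bar>
        \<le> \<bar>\<sigma> p\<bar> * (\<epsilon>\<^sup>2 * C * indicator (cball 0 (1 + norm q)) p)"
        unfolding abs_mult C_def using e by (intro mult_left_mono bump_expansion) auto
      then show ?thesis by (simp add: mult_ac abs_le_iff)
    qed
    have "(\<integral>p. \<sigma> p * bump (p - \<epsilon> *\<^sub>R q) \<partial>lborel) = (\<integral>p. \<sigma> (\<epsilon> *\<^sub>R q + p) * bump p \<partial>lborel)"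
      using lborel_integral_shift[OF cont2, of "\<epsilon> *\<^sub>R q"] by simp
    also have "\<dots> \<le> (\<integral>p. \<sigma> p * bump p + \<epsilon> * \<sigma> q * bump p \<partial>lborel)"
    proof (rule integral_mono[OF int4])
      show "integrable lborel (\<lambda>p. \<sigma> p * bump p + \<epsilon> * \<sigma> q * bump p)"
        using int1 int3 by simp
      show "\<sigma> (\<epsilon> *\<^sub>R q + p) * bump p \<le> \<sigma> p * bump p + \<epsilon> * \<sigma> q * bump p" for p
        using mult_right_mono[OF sub[of \<epsilon> p q], of "bump p"] e
        by (simp add: bump_def algebra_simps)
    qed
    also have "\<dots> = (\<integral>p. \<sigma> p * bump p \<partial>lborel) + \<epsilon> * (\<sigma> q * bump_mass TYPE('a))"
      using int1 int3 by (simp add: bump_mass_def)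
    finally have A: "(\<integral>p. \<sigma> p * bump (p - \<epsilon> *\<^sub>R q) \<partial>lborel) - (\<integral>p. \<sigma> p * bump p \<partial>lborel)
        \<le> \<epsilon> * (\<sigma> q * bump_mass TYPE('a))" by simp
    \<comment> \<open>The integrated expansion bounds \<open>\<epsilon> * I\<close> by the increment
      of the integral plus a quadratic error; \<open>A\<close> bounds that increment by
      sublinearity.\<close>
    have "- (\<epsilon>\<^sup>2 * C * J) = (\<integral>p. - (\<epsilon>\<^sup>2 * C * (indicator (cball 0 (1 + norm q)) p *\<^sub>R \<bar>\<sigma> p\<bar>)) \<partial>lborel)"
      by (simp add: J_def)
    also have "\<dots> \<le> (\<integral>p. \<sigma> p * bump (p - \<epsilon> *\<^sub>R q) - \<sigma> p * bump p - \<epsilon> * (\<sigma> p * inner (bump_slope p) q) \<partial>lborel)"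
    proof (rule integral_mono)
      show "integrable lborel (\<lambda>p. - (\<epsilon>\<^sup>2 * C * (indicator (cball 0 (1 + norm q)) p *\<^sub>R \<bar>\<sigma> p\<bar>)))"
        using intJ by (intro integrable_minus integrable_mult_right)
      show "integrable lborel (\<lambda>p. \<sigma> p * bump (p - \<epsilon> *\<^sub>R q) - \<sigma> p * bump p - \<epsilon> * (\<sigma> p * inner (bump_slope p) q))"
        using int0 int1 int2 by simp
    qed (use pt in \<open>simp add: algebra_simps\<close>)
    also have "\<dots> = (\<integral>p. \<sigma> p * bump (p - \<epsilon> *\<^sub>R q) \<partial>lborel) - (\<integral>p. \<sigma> p * bump p \<partial>lborel) - \<epsilon> * I"
      using int0 int1 int2 by (simp add: I_def)
    finally show ?thesis using A by linarith
  qed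
  have "I \<le> \<sigma> q * bump_mass TYPE('a) + \<epsilon> * (C * J)" if e: "0 < \<epsilon>" "\<epsilon> \<le> 1" for \<epsilon>
  proof -
    have "\<epsilon> * I \<le> \<epsilon> * (\<sigma> q * bump_mass TYPE('a) + \<epsilon> * (C * J))"
      using step[OF e] by (simp add: power2_eq_square algebra_simps)
    then show ?thesis using e by simp
  qed
  then have "\<forall>\<^sub>F \<epsilon> in at_right 0. I \<le> \<sigma> q * bump_mass TYPE('a) + \<epsilon> * (C * J)"
    by (auto simp: eventually_at_right_field intro!: exI[of _ 1])
  moreover have "((\<lambda>\<epsilon>. \<sigma> q * bump_mass TYPE('a) + \<epsilon> * (C * J)) \<longlongrightarrow> \<sigma> q * bump_mass TYPE('a) + 0 * (C * J)) (at_right 0)"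
    by (intro tendsto_intros)
  ultimately have "I \<le> \<sigma> q * bump_mass TYPE('a) + 0 * (C * J)"
    by (intro tendsto_lowerbound[of _ _ "at_right 0"]) auto
  then show ?thesis by (simp add: I_def)
qed

section \<open>Membership and Lipschitz dependence of Steiner points\<close>

lemma integrable_supp_fun_bump_slope:
  fixes K :: "'a::euclidean_space set"
  assumes "bounded K" "K \<noteq> {}"
  shows "integrable lborel (\<lambda>p. supp_fun K p *\<^sub>R bump_slope p)"
  by (rule integrable_continuous_compact_support[of _ 1])
     (auto intro!: continuous_intros continuous_on_supp_fun assms continuous_on_bump_slope
       simp: bump_slope_eq_zero)

text \<open>A point outside \<open>K\<close> is strictly separated from it by a hyperplane. The
  integral inequality, applied to the support function of \<open>K\<close>, gives
  \<open>inner (steiner K) q \<le> supp_fun K q\<close> for every direction \<open>q\<close>, which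
  excludes this.\<close>

lemma steiner_in:
  fixes K :: "'a::euclidean_space set"
  assumes "compact K" "convex K" "K \<noteq> {}"
  shows "steiner K \<in> K"
proof (rule ccontr)
  have bd: "bounded K" using assms(1) by (rule compact_imp_bounded)
  assume "steiner K \<notin> K"
  then obtain a b where ab: "inner a (steiner K) < b" "\<And>x. x \<in> K \<Longrightarrow> inner a x > b"
    using separating_hyperplane_closed_point[OF assms(2) compact_imp_closed[OF assms(1)]] by blast
  have "supp_fun K (- a) \<le> - b"
    using ab(2) by (intro supp_fun_least assms) (auto intro: less_imp_le)
  moreover have "inner (steiner K) (- a) \<le> supp_fun K (- a)"
  proof -
    have "inner (steiner K) (- a) = (1 / bump_mass TYPE('a)) * (\<integral>p. inner (supp_fun K p *\<^sub>R bump_slope p) (- a) \<partial>lborel)"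
      by (subst integral_inner_left[OF integrable_supp_fun_bump_slope[OF bd assms(3)]])
         (simp add: steiner_def)
    also have "\<dots> \<le> (1 / bump_mass TYPE('a)) * (supp_fun K (- a) * bump_mass TYPE('a))"
    proof (rule mult_left_mono)
      show "(\<integral>p. inner (supp_fun K p *\<^sub>R bump_slope p) (- a) \<partial>lborel) \<le> supp_fun K (- a) * bump_mass TYPE('a)"
        using integral_sublinear_bump_slope_le[OF continuous_on_supp_fun[OF bd assms(3)] supp_fun_sublinear[OF bd assms(3)], of "- a"]
        by simp
    qed (use bump_mass_pos[where 'a='a] in simp)
    also have "\<dots> = supp_fun K (- a)"
      using bump_mass_pos[where 'a='a] by simp
    finally show ?thesis .
  qed
  ultimately show False using ab(1) by (simp add: inner_commute)
qed

text \<open>This is where the dimension enters. Since \<open>bump_slope p\<close> is a nonnegative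
  multiple of \<open>p\<close>, the integrand is their inner product; expanded in the basis, each
  coordinate is a linear, hence sublinear, function of \<open>p\<close> and contributes at most one
  \<open>bump_mass\<close>.\<close>

lemma integral_norm_bump_slope:
  "(\<integral>p. norm p * norm (bump_slope (p::'a::euclidean_space)) \<partial>lborel) \<le> DIM('a) * bump_mass TYPE('a)"
proof -
  have "norm p * norm (bump_slope p) = (\<Sum>b\<in>Basis. inner p b * inner (bump_slope p) b)" for p :: 'a
  proof -
    have "norm p * norm (bump_slope p) = inner p (bump_slope p)"
      by (simp add: bump_slope_def power2_norm_eq_inner[symmetric] power2_eq_square)
    also have "\<dots> = (\<Sum>b\<in>Basis. inner p b * inner (bump_slope p) b)"
      by (rule euclidean_inner)
    finally show ?thesis .
  qed
  then have "(\<integral>p. norm p * norm (bump_slope (p::'a)) \<partial>lborel)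
      = (\<integral>p. (\<Sum>b\<in>Basis. inner p b * inner (bump_slope p) b) \<partial>(lborel :: 'a measure))"
    by simp
  also have "\<dots> = (\<Sum>b\<in>Basis. (\<integral>p. inner p b * inner (bump_slope p) b \<partial>(lborel :: 'a measure)))"
    by (rule Bochner_Integration.integral_sum, rule integrable_continuous_compact_support[of _ 1])
       (auto intro!: continuous_intros continuous_on_bump_slope simp: bump_slope_eq_zero)
  also have "\<dots> \<le> (\<Sum>b\<in>(Basis::'a set). inner b b * bump_mass TYPE('a))"
    by (intro sum_mono integral_sublinear_bump_slope_le)
       (auto intro!: continuous_intros simp: inner_add_left)
  also have "\<dots> = DIM('a) * bump_mass TYPE('a)" by simp
  finally show ?thesis .
qed

text \<open>The two support functions differ by at most \<open>D * norm p\<close>. Integrating this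
  against \<open>norm (bump_slope p)\<close> costs the dimension times \<open>bump_mass\<close>, and
  the normalisation removes the mass.\<close>

lemma steiner_lipschitz:
  fixes K L :: "'a::euclidean_space set" and D :: real
  assumes K: "bounded K" "K \<noteq> {}" and L: "bounded L" "L \<noteq> {}"
    and KL: "\<And>z. z \<in> K \<Longrightarrow> \<exists>z'\<in>L. norm (z - z') \<le> D"
    and LK: "\<And>z. z \<in> L \<Longrightarrow> \<exists>z'\<in>K. norm (z - z') \<le> D"
  shows "norm (steiner K - steiner L) \<le> DIM('a) * D"
proof -
  let ?m = "bump_mass TYPE('a)"
  have m: "?m > 0" by (rule bump_mass_pos)
  have "D \<ge> 0" using K(2) KL norm_ge_zero order_trans by blast
  have near: "\<bar>supp_fun K p - supp_fun L p\<bar> \<le> D * norm p" for p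
    using supp_fun_le_of_near[OF K(2) L(1) KL, of p] supp_fun_le_of_near[OF L(2) K(1) LK, of p] by auto
  note int = integrable_supp_fun_bump_slope[OF K] integrable_supp_fun_bump_slope[OF L]
  have int': "integrable lborel (\<lambda>p. norm p * norm (bump_slope (p::'a)))"
    by (rule integrable_continuous_compact_support[of _ 1])
       (auto intro!: continuous_intros continuous_on_bump_slope simp: bump_slope_eq_zero)
  have "steiner K - steiner L = (1 / ?m) *\<^sub>R (\<integral>p. (supp_fun K p - supp_fun L p) *\<^sub>R bump_slope p \<partial>lborel)"
    unfolding steiner_def using int by (simp add: scaleR_diff_left scaleR_diff_right)
  also have "norm \<dots> = (1 / ?m) * norm (\<integral>p. (supp_fun K p - supp_fun L p) *\<^sub>R bump_slope p \<partial>lborel)"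
    using m by simp
  also have "\<dots> \<le> (1 / ?m) * (\<integral>p. D * (norm p * norm (bump_slope (p::'a))) \<partial>lborel)"
  proof (rule mult_left_mono)
    show "norm (\<integral>p. (supp_fun K p - supp_fun L p) *\<^sub>R bump_slope p \<partial>lborel)
       \<le> (\<integral>p. D * (norm p * norm (bump_slope (p::'a))) \<partial>lborel)"
    proof (rule order_trans[OF integral_norm_bound integral_mono])
      show "integrable lborel (\<lambda>p. norm ((supp_fun K p - supp_fun L p) *\<^sub>R bump_slope p))"
        using int by (intro integrable_norm) (simp add: scaleR_diff_left)
      show "integrable lborel (\<lambda>p. D * (norm p * norm (bump_slope (p::'a))))"
        using int' by simp
      show "norm ((supp_fun K p - supp_fun L p) *\<^sub>R bump_slope p) \<le> D * (norm p * norm (bump_slope p))" for p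
        using mult_right_mono[OF near[of p] norm_ge_zero[of "bump_slope p"]] by (simp add: mult.assoc)
    qed
  qed (use m in simp)
  also have "\<dots> \<le> (1 / ?m) * (D * (DIM('a) * ?m))"
    using integral_norm_bump_slope[where 'a='a] \<open>D \<ge> 0\<close> m int'
    by (intro mult_left_mono) (auto intro!: mult_left_mono)
  also have "\<dots> = DIM('a) * D" using m by simp
  finally show ?thesis .
qed

section \<open>Lipschitz selections of closed convex sets\<close>

text \<open>With radius \<open>infdist a E\<close> this would be the nearest point alone, which is
  not Lipschitz in \<open>E\<close> for the Hausdorff distance. The factor 2 leaves room for
  Lipschitz dependence, and the radius is still zero when \<open>a\<close> lies in a closed
  \<open>E\<close>.\<close>

definition proximal_part :: "'a::euclidean_space set \<Rightarrow> 'a \<Rightarrow> 'a set" where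
  "proximal_part E a = E \<inter> cball a (2 * infdist a E)"

lemma closest_point_infdist:
  assumes "closed E" "E \<noteq> {}"
  shows "dist a (closest_point E a) = infdist a E"
  using infdist_attains_inf[OF assms, of a] closest_point_le[OF assms(1)] closest_point_in_set[OF assms]
  by (metis antisym infdist_le)

lemma proximal_part:
  assumes "closed E" "convex E" "E \<noteq> {}"
  shows compact_proximal_part: "compact (proximal_part E a)"
    and convex_proximal_part: "convex (proximal_part E a)"
    and proximal_part_nonempty: "proximal_part E a \<noteq> {}"
proof -
  show "compact (proximal_part E a)"
    unfolding proximal_part_def using assms(1) by (intro closed_Int_compact compact_cball)
  show "convex (proximal_part E a)"
    unfolding proximal_part_def using assms(2) by (intro convex_Int convex_cball)
  have "closest_point E a \<in> proximal_part E a"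
    using closest_point_in_set[OF assms(1,3)] closest_point_infdist[OF assms(1,3), of a]
      infdist_nonneg[of a E]
    by (simp add: proximal_part_def)
  then show "proximal_part E a \<noteq> {}" by blast
qed

definition proj_select :: "'a::euclidean_space set \<Rightarrow> 'a \<Rightarrow> 'a" where
  "proj_select E a = steiner (proximal_part E a)"

lemma proj_select_in:
  assumes "closed E" "convex E" "E \<noteq> {}"
  shows "proj_select E a \<in> E" "dist a (proj_select E a) \<le> 2 * infdist a E"
  using steiner_in[OF proximal_part[OF assms], of a] by (auto simp: proj_select_def proximal_part_def)

lemma proj_select_of_mem:
  assumes "closed E" "convex E" "a \<in> E"
  shows "proj_select E a = a"
proof -
  have "E \<noteq> {}" using assms(3) by blast
  from proj_select_in(2)[OF assms(1,2) this, of a] show ?thesis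
    using assms(3) by simp
qed

text \<open>A one-sided Hausdorff bound that tests only the points of \<open>E\<close> in a ball;
  the partner in \<open>E'\<close> may lie outside it. Epigraphs are unbounded, and locally uniform
  closeness of functions controls only such truncations.\<close>

definition local_near :: "real \<Rightarrow> real \<Rightarrow> 'a::real_normed_vector set \<Rightarrow> 'a set \<Rightarrow> bool" where
  "local_near \<rho> \<delta> E E' \<longleftrightarrow> (\<forall>z\<in>E. norm z \<le> \<rho> \<longrightarrow> (\<exists>z'\<in>E'. norm (z - z') \<le> \<delta>))"

text \<open>Go from \<open>b\<close> to \<open>a\<close>, on to the point of \<open>E\<close>
  nearest to \<open>a\<close>, and then to its partner in \<open>E'\<close>. The condition on \<rho>
  keeps that nearest point inside the tested ball.\<close>

lemma infdist_le_of_local_near: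
  fixes E E' :: "'a::euclidean_space set"
  assumes E: "closed E" "E \<noteq> {}"
    and near: "local_near \<rho> \<delta> E E'" and \<rho>: "norm a + infdist a E \<le> \<rho>"
  shows "infdist b E' \<le> infdist a E + norm (a - b) + \<delta>"
proof -
  let ?y = "closest_point E a"
  have y: "?y \<in> E" "norm (a - ?y) = infdist a E"
    using closest_point_in_set[OF E] closest_point_infdist[OF E, of a] by (auto simp: dist_norm)
  have "norm ?y \<le> norm a + norm (a - ?y)"
    using norm_triangle_ineq4[of a "a - ?y"] by simp
  then obtain z' where z': "z' \<in> E'" "norm (?y - z') \<le> \<delta>"
    using near y \<rho> by (auto simp: local_near_def)
  have "infdist b E' \<le> norm (b - z')"
    using infdist_le[OF z'(1)] by (simp add: dist_norm)
  also have "b - z' = (b - a) + (a - ?y) + (?y - z')" by simp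
  also have "norm \<dots> \<le> norm (b - a) + norm (a - ?y) + norm (?y - z')"
    by (intro norm_triangle_le add_mono order_refl norm_triangle_ineq)
  finally show ?thesis using y z' by (simp add: norm_minus_commute)
qed

text \<open>Starting at a point \<open>w\<close> at distance at most \<open>2 d + 3 \<eta>\<close> from \<open>b\<close>, one moves towards the
  projection \<open>y\<close> of \<open>b\<close>. Since the angle at \<open>y\<close> is obtuse, \<open>\<bar>w - y\<bar>\<^sup>2 \<le> (2 d + 3 \<eta>)\<^sup>2 - d\<^sup>2\<close>; the
  triangle inequality alone would give a constant that is too large for the theorem.\<close>

lemma pull_into_proximal_part:
  fixes E :: "'a::euclidean_space set"
  assumes E: "closed E" "convex E" and w: "w \<in> E"
    and dist_w: "norm (w - b) \<le> 2 * infdist b E + 3 * \<eta>" and "\<eta> \<ge> 0"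
  shows "\<exists>z\<in>proximal_part E b. norm (w - z) \<le> 5.2 * \<eta>"
proof -
  define d where "d = infdist b E"
  define y where "y = closest_point E b"
  have ne: "E \<noteq> {}" using w by blast
  have d0: "d \<ge> 0" by (simp add: d_def infdist_nonneg)
  have y: "y \<in> E" "norm (b - y) = d"
    using closest_point_in_set[OF E(1) ne] closest_point_infdist[OF E(1) ne, of b]
    by (auto simp: dist_norm y_def d_def)
  show ?thesis
  proof (cases "d + 3 * \<eta> = 0")
    case True
    then have "d = 0" "\<eta> = 0" using d0 \<open>\<eta> \<ge> 0\<close> by auto
    then have "w \<in> proximal_part E b"
      using w dist_w by (simp add: proximal_part_def d_def[symmetric] dist_norm norm_minus_commute)
    then show ?thesis using \<open>\<eta> = 0\<close> by (intro bexI[of _ w]) auto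
  next
    case False
    then have pos: "d + 3 * \<eta> > 0" using d0 \<open>\<eta> \<ge> 0\<close> by linarith
    \<comment> \<open>Chosen so that
      \<open>(1 - \<mu>) * (2 * d + 3 * \<eta>) + \<mu> * d = 2 * d\<close>, which brings the moved
      point exactly within the allowed radius.\<close>
    define \<mu> where "\<mu> = 3 * \<eta> / (d + 3 * \<eta>)"
    have \<mu>: "0 \<le> \<mu>" "\<mu> \<le> 1" "\<mu> * (d + 3 * \<eta>) = 3 * \<eta>"
      using pos d0 \<open>\<eta> \<ge> 0\<close> by (auto simp: \<mu>_def divide_simps)
    define z where "z = (1 - \<mu>) *\<^sub>R w + \<mu> *\<^sub>R y"
    have "z \<in> E"
      using convexD[OF E(2) w y(1), of "1 - \<mu>" \<mu>] \<mu> by (simp add: z_def)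
    have "z - b = (1 - \<mu>) *\<^sub>R (w - b) + \<mu> *\<^sub>R (y - b)"
      by (simp add: z_def algebra_simps)
    then have "norm (z - b) \<le> (1 - \<mu>) * norm (w - b) + \<mu> * d"
      using norm_triangle_ineq[of "(1 - \<mu>) *\<^sub>R (w - b)" "\<mu> *\<^sub>R (y - b)"] \<mu> y(2)
      by (simp add: norm_minus_commute)
    also have "\<dots> \<le> (1 - \<mu>) * (2 * d + 3 * \<eta>) + \<mu> * d"
      using dist_w \<mu> by (auto simp: d_def intro!: mult_left_mono)
    also have "\<dots> = 2 * d"
      using \<mu>(3) by (simp add: algebra_simps)
    finally have z: "z \<in> proximal_part E b"
      using \<open>z \<in> E\<close> by (simp add: proximal_part_def d_def dist_norm norm_minus_commute)
    have "inner (b - y) (w - y) \<le> 0"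
      unfolding y_def by (rule closest_point_dot[OF E(2,1) w])
    then have "(norm (w - y))\<^sup>2 \<le> (norm (w - b))\<^sup>2 - (norm (b - y))\<^sup>2"
      unfolding power2_norm_eq_inner
      by (simp add: inner_diff_left inner_diff_right inner_commute)
    also have "\<dots> \<le> (2 * d + 3 * \<eta>)\<^sup>2 - d\<^sup>2"
      using dist_w y(2) by (simp add: d_def power_mono)
    also have "\<dots> \<le> 3 * (d + 3 * \<eta>)\<^sup>2"
      using d0 \<open>\<eta> \<ge> 0\<close> by (simp add: power2_eq_square algebra_simps)
    finally have "\<mu>\<^sup>2 * (norm (w - y))\<^sup>2 \<le> \<mu>\<^sup>2 * (3 * (d + 3 * \<eta>)\<^sup>2)"
      by (intro mult_left_mono) auto
    also have "\<dots> = 3 * (\<mu> * (d + 3 * \<eta>))\<^sup>2" by (simp add: power_mult_distrib)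
    \<comment> \<open>The constant 5.2 comes from \<open>3 * 3\<^sup>2 = 27\<close> and
      \<open>5.2\<^sup>2 = 27.04\<close>.\<close>
    also have "\<dots> \<le> (5.2 * \<eta>)\<^sup>2" unfolding \<mu>(3) by (simp add: power_mult_distrib power2_eq_square)
    finally have "(\<mu> * norm (w - y))\<^sup>2 \<le> (5.2 * \<eta>)\<^sup>2"
      by (simp only: power_mult_distrib)
    moreover have "0 \<le> 5.2 * \<eta>" using \<open>\<eta> \<ge> 0\<close> by simp
    ultimately have "\<mu> * norm (w - y) \<le> 5.2 * \<eta>"
      by (rule power2_le_imp_le)
    moreover have "w - z = \<mu> *\<^sub>R (w - y)"
      by (simp add: z_def algebra_simps)
    ultimately show ?thesis using z \<mu>(1) by (intro bexI[of _ z]) auto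
  qed
qed

text \<open>Replace \<open>z\<close> by a partner \<open>w\<close> in \<open>E'\<close> at distance
  at most \<delta>. Comparing the two radii shows that \<open>w\<close> misses the ball around
  \<open>b\<close> by at most \<open>3 * \<eta>\<close>, so it can be pulled in at cost
  \<open>5.2 * \<eta>\<close>; the first move accounts for the remaining unit in 6.2.\<close>

lemma proximal_part_near:
  fixes E E' :: "'a::euclidean_space set"
  assumes E: "closed E" "E \<noteq> {}" and E': "closed E'" "convex E'" "E' \<noteq> {}"
    and near: "local_near \<rho> \<delta> E E'" "local_near \<rho> \<delta> E' E" and "\<delta> \<ge> 0"
    and \<rho>: "norm a + 2 * infdist a E \<le> \<rho>" "norm b + infdist b E' \<le> \<rho>"
    and z: "z \<in> proximal_part E a"
  shows "\<exists>z'\<in>proximal_part E' b. norm (z - z') \<le> 6.2 * (\<delta> + norm (a - b))"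
proof -
  define \<eta> where "\<eta> = \<delta> + norm (a - b)"
  have \<eta>: "\<eta> \<ge> 0" using \<open>\<delta> \<ge> 0\<close> by (simp add: \<eta>_def)
  have z: "z \<in> E" "norm (z - a) \<le> 2 * infdist a E"
    using z by (auto simp: proximal_part_def dist_norm norm_minus_commute)
  have "norm z \<le> norm a + norm (z - a)"
    using norm_triangle_ineq[of a "z - a"] by simp
  then obtain w where w: "w \<in> E'" "norm (z - w) \<le> \<delta>"
    using near(1) z \<rho> by (auto simp: local_near_def)
  have "infdist a E \<le> infdist b E' + norm (b - a) + \<delta>"
    by (rule infdist_le_of_local_near[OF E'(1,3) near(2) \<rho>(2)])
  moreover have "norm (w - b) \<le> norm (w - z) + norm (z - a) + norm (a - b)"
    using norm_triangle_ineq[of "w - z" "z - a"] norm_triangle_ineq[of "w - a" "a - b"] by simp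
  ultimately have "norm (w - b) \<le> 2 * infdist b E' + 3 * \<eta>"
    using z(2) w(2) by (simp add: \<eta>_def norm_minus_commute)
  from pull_into_proximal_part[OF E'(1,2) w(1) this \<eta>]
  obtain z' where z': "z' \<in> proximal_part E' b" "norm (w - z') \<le> 5.2 * \<eta>" by blast
  have "norm (z - z') \<le> norm (z - w) + norm (w - z')"
    using norm_triangle_ineq[of "z - w" "w - z'"] by simp
  also have "\<dots> \<le> \<eta> + 5.2 * \<eta>"
    using w(2) z'(2) by (simp add: \<eta>_def add_mono add_increasing2)
  finally show ?thesis using z'(1) unfolding \<eta>_def[symmetric] by (intro bexI[of _ z']) auto
qed

text \<open>Proximal parts are Hausdorff close in both directions, so their Steiner points are
  close. The slack of three times the error in the condition on \<rho> transfers that condition from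
  \<open>a\<close> and \<open>E\<close> to \<open>b\<close> and \<open>E'\<close>.\<close>

lemma proj_select_local_lipschitz:
  fixes E E' :: "'a::euclidean_space set"
  assumes E: "closed E" "convex E" "E \<noteq> {}" and E': "closed E'" "convex E'" "E' \<noteq> {}"
    and near: "local_near \<rho> \<delta> E E'" "local_near \<rho> \<delta> E' E" and "\<delta> \<ge> 0"
    and \<rho>: "norm a + 2 * infdist a E + 3 * (\<delta> + norm (a - b)) \<le> \<rho>"
  shows "norm (proj_select E a - proj_select E' b) \<le> DIM('a) * (6.2 * (\<delta> + norm (a - b)))"
proof -
  have \<rho>1: "norm a + 2 * infdist a E \<le> \<rho>"
  proof -
    have "0 \<le> 3 * (\<delta> + norm (a - b))" using \<open>\<delta> \<ge> 0\<close> by simp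
    then show ?thesis using \<rho> by linarith
  qed
  have "infdist b E' \<le> infdist a E + norm (a - b) + \<delta>"
    using \<rho>1 infdist_nonneg[of a E] by (intro infdist_le_of_local_near[OF E(1,3) near(1)]) linarith
  moreover have "norm b \<le> norm a + norm (a - b)"
    using norm_triangle_ineq4[of a "a - b"] by simp
  ultimately have \<rho>2: "norm b + 2 * infdist b E' \<le> \<rho>" using \<rho> \<open>\<delta> \<ge> 0\<close> by argo
  have \<rho>3: "norm a + infdist a E \<le> \<rho>" "norm b + infdist b E' \<le> \<rho>"
    using \<rho>1 \<rho>2 infdist_nonneg[of a E] infdist_nonneg[of b E'] by linarith+
  note ab = norm_minus_commute[of a b]
  show ?thesis
    unfolding proj_select_def
    using proximal_part_near[OF E(1,3) E' near \<open>\<delta> \<ge> 0\<close> \<rho>1 \<rho>3(2)]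
      proximal_part_near[OF E'(1,3) E near(2,1) \<open>\<delta> \<ge> 0\<close> \<rho>2 \<rho>3(1)]
      compact_imp_bounded[OF compact_proximal_part[OF E]] proximal_part_nonempty[OF E]
      compact_imp_bounded[OF compact_proximal_part[OF E']] proximal_part_nonempty[OF E']
    by (intro steiner_lipschitz) (auto simp: ab)
qed

section \<open>Epigraphs of conjugate functions\<close>

lemma norm_le_of_inner_le:
  fixes w :: "'a::real_inner"
  assumes "L \<ge> 0" "\<And>p. inner w p \<le> b + L * norm p"
  shows "norm w \<le> L"
proof (rule ccontr)
  assume "\<not> norm w \<le> L"
  then have L: "norm w - L > 0" "w \<noteq> 0" using assms(1) by auto
  define s where "s = (\<bar>b\<bar> + 1) / (norm w * (norm w - L))"
  have s: "s > 0" using L by (simp add: s_def)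
  have "inner w (s *\<^sub>R w) = s * norm w * norm w"
    by (simp add: power2_norm_eq_inner[symmetric] power2_eq_square)
  then have "s * norm w * norm w \<le> b + L * (s * norm w)"
    using assms(2)[of "s *\<^sub>R w"] s by simp
  then have "s * (norm w * (norm w - L)) \<le> b" by (simp add: algebra_simps)
  moreover have "s * (norm w * (norm w - L)) = \<bar>b\<bar> + 1"
    using L by (simp add: s_def)
  ultimately show False by linarith
qed

text \<open>A sandwich theorem: a hyperplane separates the epigraph of \<open>g\<close> from the
  open region below the concave cone \<open>- \<kappa> * norm p\<close>. It is not vertical, and its
  slope is the required \<open>w\<close>.\<close>

lemma convex_linear_minorant:
  fixes g :: "'a::euclidean_space \<Rightarrow> real"
  assumes g: "convex_on UNIV g" and \<kappa>: "\<kappa> \<ge> 0" and lower: "\<And>p. g p \<ge> - \<kappa> * norm p"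
  obtains w where "norm w \<le> \<kappa>" "\<And>p. inner w p \<le> g p"
proof -
  define A where "A = epigraph UNIV g"
  define B where "B = {z::'a \<times> real. snd z < - \<kappa> * norm (fst z)}"
  have "convex A" using g by (simp add: A_def convex_epigraph)
  moreover have "convex B"
  proof (rule convexI)
    fix x y :: "'a \<times> real" and u v :: real
    assume xy: "x \<in> B" "y \<in> B" and uv: "0 \<le> u" "0 \<le> v" "u + v = 1"
    have "\<kappa> * norm (u *\<^sub>R fst x + v *\<^sub>R fst y) \<le> \<kappa> * (u * norm (fst x) + v * norm (fst y))"
      using uv \<kappa> by (intro mult_left_mono norm_triangle_le) auto
    moreover have "u * snd x + v * snd y < u * (- \<kappa> * norm (fst x)) + v * (- \<kappa> * norm (fst y))"
    proof (cases "u = 0")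
      case True
      then show ?thesis using xy uv by (simp add: B_def)
    next
      case False
      then have "u * snd x < u * (- \<kappa> * norm (fst x))"
        using xy uv by (intro mult_strict_left_mono) (auto simp: B_def)
      moreover have "v * snd y \<le> v * (- \<kappa> * norm (fst y))"
        using xy uv by (intro mult_left_mono) (auto simp: B_def)
      ultimately show ?thesis by linarith
    qed
    ultimately have "u * snd x + v * snd y < - (\<kappa> * norm (u *\<^sub>R fst x + v *\<^sub>R fst y))"
      by argo
    then show "u *\<^sub>R x + v *\<^sub>R y \<in> B"
      by (simp add: B_def)
  qed
  moreover have "(0, g 0) \<in> A" by (simp add: A_def epigraph_def)
  moreover have "(0, -1) \<in> B" by (simp add: B_def)
  moreover have "A \<inter> B = {}"
    using lower by (auto simp: A_def B_def epigraph_def) (smt (verit))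
  ultimately obtain a b where ab: "a \<noteq> 0" "\<forall>z\<in>A. inner a z \<le> b" "\<forall>z\<in>B. b \<le> inner a z"
    using separating_hyperplane_sets[of A B] by blast
  obtain u \<beta> where a: "a = (u, \<beta>)" by (cases a)
  have epi: "inner u p + \<beta> * y \<le> b" if "y \<ge> g p" for p y
    using ab(2) that by (auto simp: A_def epigraph_def a)
  have hypo: "b \<le> inner u p + \<beta> * y" if "y < - \<kappa> * norm p" for p y
    using ab(3) that by (auto simp: B_def a)
  \<comment> \<open>The region \<open>B\<close> is strict, to make it disjoint from the epigraph; a
    limit from below recovers the inequality on the cone itself.\<close>
  have hypo': "b \<le> inner u p - \<beta> * \<kappa> * norm p" for p
  proof (rule tendsto_lowerbound)
    show "((\<lambda>y. inner u p + \<beta> * y) \<longlongrightarrow> inner u p - \<beta> * \<kappa> * norm p) (at_left (- \<kappa> * norm p))"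
      by (auto intro!: tendsto_eq_intros)
    show "\<forall>\<^sub>F y in at_left (- \<kappa> * norm p). b \<le> inner u p + \<beta> * y"
      using hypo by (auto simp: eventually_at_left_field intro!: exI[of _ "- \<kappa> * norm p - 1"])
  qed simp
  \<comment> \<open>This sign lets the offset be dropped from \<open>epi\<close>, so the minorant is
    linear and not merely affine.\<close>
  have b: "b \<le> 0" using hypo'[of 0] by simp
  \<comment> \<open>A positive \<beta> fails at points high in the epigraph. If \<beta> were zero,
    \<open>inner u\<close> would be constant, so \<open>u = 0\<close>, against the nonzero
    normal.\<close>
  have "\<beta> < 0"
  proof -
    have "\<beta> \<le> 0"
    proof (rule ccontr)
      assume "\<not> \<beta> \<le> 0"
      then have "\<beta> * (\<bar>g 0\<bar> + (\<bar>b\<bar> + 1) / \<beta>) \<ge> \<bar>b\<bar> + 1"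
        by (simp add: field_simps)
      moreover have "(\<bar>b\<bar> + 1) / \<beta> \<ge> 0" using \<open>\<not> \<beta> \<le> 0\<close> by simp
      then have "\<bar>g 0\<bar> + (\<bar>b\<bar> + 1) / \<beta> \<ge> g 0" by linarith
      ultimately show False
        using epi[of 0 "\<bar>g 0\<bar> + (\<bar>b\<bar> + 1) / \<beta>"] by simp
    qed
    moreover have "\<beta> \<noteq> 0"
    proof
      assume "\<beta> = 0"
      then have "inner u p = b" for p
        using epi[of p "g p"] hypo'[of p] by (intro antisym) auto
      from this[of u] this[of 0] have "u = 0" by simp
      then show False using ab(1) a \<open>\<beta> = 0\<close> by (simp add: zero_prod_def)
    qed
    ultimately show ?thesis by simp
  qed
  define w where "w = (1 / - \<beta>) *\<^sub>R u"
  have u: "inner u p = - \<beta> * inner w p" for p using \<open>\<beta> < 0\<close> by (simp add: w_def)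
  show ?thesis
  proof
    show "inner w p \<le> g p" for p
    proof -
      have "- \<beta> * inner w p \<le> - \<beta> * g p" using epi[of p "g p"] u b by simp
      then show ?thesis using \<open>\<beta> < 0\<close> by (simp add: mult_le_cancel_left)
    qed
    show "norm w \<le> \<kappa>"
    proof (rule norm_le_of_inner_le[OF \<kappa>])
      fix p :: 'a
      have "- \<beta> * inner w (- p) \<ge> b - \<beta> * \<kappa> * (- norm p)"
        using hypo'[of "- p"] u by simp
      then show "inner w p \<le> (- b / - \<beta>) + \<kappa> * norm p"
        using \<open>\<beta> < 0\<close> by (simp add: field_simps)
    qed
  qed
qed

text \<open>A pair belongs to the epigraph of the conjugate exactly when it describes an affine
  minorant of \<open>h\<close>. This form avoids extended reals and exhibits the set as an
  intersection of closed half-spaces.\<close>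

definition conj_epi :: "('a::euclidean_space \<Rightarrow> real) \<Rightarrow> ('a \<times> real) set" where
  "conj_epi h = {(v, r). \<forall>p. inner v p - r \<le> h p}"

lemma mem_conj_epi [simp]: "(v, r) \<in> conj_epi h \<longleftrightarrow> (\<forall>p. inner v p - r \<le> h p)"
  by (simp add: conj_epi_def)

lemma Hconj_epi_eq: "Hconj_epi H t x = conj_epi (H t x)"
proof -
  have "Hconj H t x v \<le> ereal r \<longleftrightarrow> (\<forall>p. inner v p - r \<le> H t x p)" for v r
    unfolding Hconj_def SUP_le_iff by (auto simp: algebra_simps)
  then show ?thesis by (auto simp: Hconj_epi_def)
qed

lemma Hconj_dom_eq: "Hconj_dom H t x = fst ` conj_epi (H t x)"
proof -
  have "Hconj H t x v < \<infinity> \<longleftrightarrow> (\<exists>r. Hconj H t x v \<le> ereal r)" for v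
    by (cases "Hconj H t x v") (auto intro: exI[of _ 0])
  then show ?thesis
    by (force simp: Hconj_dom_def Hconj_epi_eq[symmetric] Hconj_epi_def)
qed

lemma closed_conj_epi: "closed (conj_epi h)"
proof -
  have "conj_epi h = (\<Inter>p. {z. inner (fst z) p - snd z \<le> h p})"
    by (auto simp: conj_epi_def)
  also have "closed \<dots>"
    by (intro closed_INT ballI closed_Collect_le continuous_intros)
  finally show ?thesis .
qed

lemma convex_conj_epi: "convex (conj_epi h)"
proof (rule convexI)
  fix x y :: "'a \<times> real" and u v :: real
  assume xy: "x \<in> conj_epi h" "y \<in> conj_epi h" and uv: "0 \<le> u" "0 \<le> v" "u + v = 1"
  have "inner (fst (u *\<^sub>R x + v *\<^sub>R y)) p - snd (u *\<^sub>R x + v *\<^sub>R y) \<le> h p" for p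
  proof -
    have "u * (inner (fst x) p - snd x) \<le> u * h p" "v * (inner (fst y) p - snd y) \<le> v * h p"
      using xy uv by (auto simp: conj_epi_def intro!: mult_left_mono)
    moreover have "u * h p + v * h p = h p" using uv by (simp flip: distrib_right)
    ultimately show ?thesis by (simp add: inner_add_left algebra_simps)
  qed
  then show "u *\<^sub>R x + v *\<^sub>R y \<in> conj_epi h"
    by (cases "u *\<^sub>R x + v *\<^sub>R y") (simp add: conj_epi_def)
qed

lemma convex_on_affine_shift:
  fixes h :: "'a::real_inner \<Rightarrow> real"
  assumes "convex_on UNIV h"
  shows "convex_on UNIV (\<lambda>p. h (q + p) - inner v p + c)"
proof (rule convex_onI)
  fix t :: real and x y :: 'a
  assume t: "0 < t" "t < 1"
  have eq: "q + ((1 - t) *\<^sub>R x + t *\<^sub>R y) = (1 - t) *\<^sub>R (q + x) + t *\<^sub>R (q + y)"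
    by (simp add: algebra_simps)
  have "h (q + ((1 - t) *\<^sub>R x + t *\<^sub>R y)) \<le> (1 - t) * h (q + x) + t * h (q + y)"
    unfolding eq using t by (intro convex_onD[OF assms]) auto
  then show "h (q + ((1 - t) *\<^sub>R x + t *\<^sub>R y)) - inner v ((1 - t) *\<^sub>R x + t *\<^sub>R y) + c
      \<le> (1 - t) * (h (q + x) - inner v x + c) + t * (h (q + y) - inner v y + c)"
    by (simp add: inner_add_right algebra_simps)
qed simp

text \<open>The Lipschitz bound puts a cone below the increments of \<open>h\<close> at
  \<open>p\<close>, so a linear minorant of these increments exists: a subgradient. The resulting
  affine minorant touches \<open>h\<close> at \<open>p\<close>; this yields nonempty epigraphs and,
  later, attainment of the supremum.\<close>

lemma conj_epi_subgradient:
  fixes h :: "'a::euclidean_space \<Rightarrow> real"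
  assumes h: "convex_on UNIV h" and lip: "\<And>p q. \<bar>h p - h q\<bar> \<le> L * norm (p - q)" and "L \<ge> 0"
  obtains v where "(v, inner v p - h p) \<in> conj_epi h"
proof -
  have "h (p + q) - inner 0 q + - h p \<ge> - L * norm q" for q
    using lip[of "p + q" p] by auto
  from convex_linear_minorant[OF convex_on_affine_shift[OF h, of p 0 "- h p"] \<open>L \<ge> 0\<close> this]
  obtain v where v: "\<And>q. inner v q \<le> h (p + q) - inner 0 q + - h p" by blast
  have "inner v q - (inner v p - h p) \<le> h q" for q
    using v[of "q - p"] by (simp add: inner_diff_right)
  then show ?thesis by (intro that[of v]) simp
qed

text \<open>A linear function bounded by an \<open>L\<close>-Lipschitz one up to a constant has
  slope at most \<open>L\<close>; evaluation at \<open>0\<close> bounds the height.\<close>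

lemma conj_epi_bounds:
  assumes lip: "\<And>p q. \<bar>h p - h q\<bar> \<le> L * norm (p - q)" and "L \<ge> 0" and "(v, r) \<in> conj_epi h"
  shows "norm v \<le> L" "r \<ge> - h 0"
proof -
  show "norm v \<le> L"
  proof (rule norm_le_of_inner_le[OF \<open>L \<ge> 0\<close>])
    fix p
    have "inner v p - r \<le> h p" using assms(3) by simp
    then show "inner v p \<le> (r + h 0) + L * norm p" using lip[of p 0] by auto
  qed
  have "inner v 0 - r \<le> h 0" using assms(3) unfolding mem_conj_epi by blast
  then show "r \<ge> - h 0" by simp
qed

text \<open>An affine function that exceeds \<open>h\<close> by at most
  \<open>\<epsilon> + \<kappa> * norm p\<close> becomes a minorant after lowering it by \<epsilon>
  and tilting its slope by at most \<kappa>. The tilt is the linear minorant of the convex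
  difference, which lies above a cone.\<close>

lemma conj_epi_perturb:
  fixes h :: "'a::euclidean_space \<Rightarrow> real"
  assumes h: "convex_on UNIV h" and "\<kappa> \<ge> 0"
    and le: "\<And>p. inner v p - r \<le> h p + \<epsilon> + \<kappa> * norm p"
  shows "\<exists>w. norm w \<le> \<kappa> \<and> (v + w, r + \<epsilon>) \<in> conj_epi h"
proof -
  have "h (0 + p) - inner v p + (r + \<epsilon>) \<ge> - \<kappa> * norm p" for p
    using le[of p] by simp
  from convex_linear_minorant[OF convex_on_affine_shift[OF h, of 0 v "r + \<epsilon>"] \<open>\<kappa> \<ge> 0\<close> this]
  obtain w where w: "norm w \<le> \<kappa>" "\<And>p. inner w p \<le> h (0 + p) - inner v p + (r + \<epsilon>)" by blast
  have "(v + w, r + \<epsilon>) \<in> conj_epi h"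
    using w(2) by (simp add: inner_add_left algebra_simps)
  then show ?thesis using w(1) by blast
qed

lemma norm_pair_diff_le:
  assumes "norm w \<le> a" "\<bar>s\<bar> \<le> b"
  shows "norm ((v, r) - (v + w, r + s)) \<le> sqrt (a\<^sup>2 + b\<^sup>2)"
  using assms power_mono[of "norm w" a 2] power_mono[of "\<bar>s\<bar>" b 2]
  by (simp add: norm_Pair)

text \<open>Slope and height each move by at most \<open>K\<close>, hence the factor
  \<open>sqrt 2\<close>. The radius \<rho> is arbitrary because the comparison of the functions is
  global.\<close>

lemma local_near_conj_epi_global:
  assumes "convex_on UNIV h'" "K \<ge> 0" and le: "\<And>p. h p \<le> h' p + K * (1 + norm p)"
  shows "local_near \<rho> (sqrt 2 * K) (conj_epi h) (conj_epi h')"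
  unfolding local_near_def
proof (intro ballI impI)
  fix z assume z: "z \<in> conj_epi h"
  obtain v r where vr: "z = (v, r)" by (cases z)
  have "inner v p - r \<le> h' p + K + K * norm p" for p
  proof -
    have "inner v p - r \<le> h p" using z by (simp add: vr)
    then show ?thesis using le[of p] by (simp add: distrib_left)
  qed
  from conj_epi_perturb[OF assms(1,2) this]
  obtain w where w: "norm w \<le> K" "(v + w, r + K) \<in> conj_epi h'" by blast
  have "norm (z - (v + w, r + K)) \<le> sqrt (K\<^sup>2 + K\<^sup>2)"
    unfolding vr using w assms(2) by (intro norm_pair_diff_le) auto
  also have "\<dots> = sqrt 2 * K"
    using assms(2) by (simp add: real_sqrt_mult flip: mult_2)
  finally show "\<exists>z'\<in>conj_epi h'. norm (z - z') \<le> sqrt 2 * K" using w(2) by blast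
qed

text \<open>Inside the ball the hypothesis is the approximation itself; outside of it convexity propagates
  the lower bound along rays from the origin, at the cost of the slope \<open>M / \<rho>\<close>.\<close>

lemma local_near_conj_epi_local:
  fixes h h' :: "'a::euclidean_space \<Rightarrow> real"
  assumes h': "convex_on UNIV h'" and "R > 0" "\<epsilon> \<ge> 0"
    and near: "\<And>p. norm p \<le> R \<Longrightarrow> \<bar>h p - h' p\<bar> \<le> \<epsilon>"
    and M: "\<bar>h' 0\<bar> + \<rho> + \<epsilon> \<le> M"
  shows "local_near \<rho> (M / R + \<epsilon>) (conj_epi h) (conj_epi h')"
  unfolding local_near_def
proof (intro ballI impI)
  fix z assume z: "z \<in> conj_epi h" "norm z \<le> \<rho>"
  obtain v r where vr: "z = (v, r)" by (cases z)
  have r: "\<bar>r\<bar> \<le> \<rho>" using z(2) norm_snd_le[of r v] by (simp add: vr)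
  then have M0: "M \<ge> 0" using M \<open>\<epsilon> \<ge> 0\<close> by linarith
  define g where "g p = h' p - inner v p + (r + \<epsilon>)" for p
  have g: "convex_on UNIV g"
    using convex_on_affine_shift[OF h', of 0 v "r + \<epsilon>"] by (simp add: g_def[abs_def])
  have inside: "g p \<ge> 0" if "norm p \<le> R" for p
  proof -
    have "inner v p - r \<le> h p" using z(1) by (simp add: vr)
    then show ?thesis using near[OF that] by (simp add: g_def abs_le_iff)
  qed
  have "g 0 \<le> M" using r M by (simp add: g_def)
  have lower: "- (M / R) * norm p \<le> g p" for p
  proof (cases "norm p \<le> R")
    case True
    have "M / R * norm p \<ge> 0" using M0 \<open>R > 0\<close> by simp
    then show ?thesis using inside[OF True] by simp
  next
    case False
    \<comment> \<open>The point \<open>s *\<^sub>R p\<close> lies on the sphere of radius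
      \<open>R\<close>, where \<open>g\<close> is nonnegative; convexity between \<open>0\<close>
      and \<open>p\<close> then bounds \<open>g p\<close> from below.\<close>
    define s where "s = R / norm p"
    have s: "0 < s" "s < 1" "s * norm p = R"
      using False \<open>R > 0\<close> by (auto simp: s_def divide_simps)
    have "0 \<le> g (s *\<^sub>R p)" using s by (intro inside) simp
    also have "\<dots> \<le> (1 - s) * g 0 + s * g p"
      using convex_onD[OF g, of s 0 p] s by simp
    also have "(1 - s) * g 0 \<le> 1 * M"
      using s inside[of 0] \<open>R > 0\<close> \<open>g 0 \<le> M\<close> by (intro mult_mono) auto
    finally have "0 \<le> (M + s * g p) / s" using s by simp
    also have "\<dots> = M / s + g p" using s by (simp add: field_simps)
    also have "M / s = M / R * norm p" by (simp add: s_def)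
    finally show ?thesis by simp
  qed
  have "inner v p - r \<le> h' p + \<epsilon> + M / R * norm p" for p
    using lower[of p] by (simp add: g_def)
  from conj_epi_perturb[OF h' _ this]
  obtain w where w: "norm w \<le> M / R" "(v + w, r + \<epsilon>) \<in> conj_epi h'"
    using M0 \<open>R > 0\<close> by auto
  have "norm (z - (v + w, r + \<epsilon>)) \<le> sqrt ((M / R)\<^sup>2 + \<epsilon>\<^sup>2)"
    unfolding vr using w \<open>\<epsilon> \<ge> 0\<close> by (intro norm_pair_diff_le) auto
  also have "\<dots> \<le> M / R + \<epsilon>"
    using M0 \<open>R > 0\<close> \<open>\<epsilon> \<ge> 0\<close> by (intro sqrt_sum_squares_le_sum) auto
  finally show "\<exists>z'\<in>conj_epi h'. norm (z - z') \<le> M / R + \<epsilon>" using w(2) by blast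
qed

section \<open>Dependence of the selection on the convex function\<close>

definition epi_select :: "('a::euclidean_space \<Rightarrow> real) \<Rightarrow> 'a \<times> real \<Rightarrow> 'a \<times> real" where
  "epi_select h a = proj_select (conj_epi h) a"

lemma epi_select_in: "conj_epi h \<noteq> {} \<Longrightarrow> epi_select h a \<in> conj_epi h"
  unfolding epi_select_def by (intro proj_select_in closed_conj_epi convex_conj_epi)

lemma epi_select_of_mem: "a \<in> conj_epi h \<Longrightarrow> epi_select h a = a"
  unfolding epi_select_def by (intro proj_select_of_mem closed_conj_epi convex_conj_epi)

lemma dist_epi_select_le:
  assumes "z \<in> conj_epi h"
  shows "norm (epi_select h a - a) \<le> 2 * norm (a - z)"
proof -
  have "conj_epi h \<noteq> {}" using assms by blast
  from proj_select_in(2)[OF closed_conj_epi convex_conj_epi this, of a] infdist_le[OF assms, of a]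
  show ?thesis by (simp add: epi_select_def dist_norm norm_minus_commute)
qed

text \<open>The dimension is that of the product with the reals, hence one more than DIM('a). The
  constant 10 absorbs 6.2 times \<open>sqrt 2\<close>, since \<open>6.2 * 1.5 = 9.3\<close>.\<close>

lemma epi_select_lipschitz:
  fixes h h' :: "'a::euclidean_space \<Rightarrow> real"
  assumes h: "convex_on UNIV h" "conj_epi h \<noteq> {}" and h': "convex_on UNIV h'" "conj_epi h' \<noteq> {}"
    and "K \<ge> 0" and le: "\<And>p. \<bar>h p - h' p\<bar> \<le> K * (1 + norm p)"
  shows "norm (epi_select h a - epi_select h' b) \<le> 10 * (real DIM('a) + 1) * (K + norm (a - b))"
proof -
  have "h p \<le> h' p + K * (1 + norm p)" "h' p \<le> h p + K * (1 + norm p)" for p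
    using le[of p] by linarith+
  note near = local_near_conj_epi_global[OF h'(1) \<open>K \<ge> 0\<close> this(1)]
    local_near_conj_epi_global[OF h(1) \<open>K \<ge> 0\<close> this(2)]
  have "norm (epi_select h a - epi_select h' b)
      \<le> real DIM('a \<times> real) * (6.2 * (sqrt 2 * K + norm (a - b)))"
    unfolding epi_select_def
    by (rule proj_select_local_lipschitz[OF closed_conj_epi convex_conj_epi h(2)
          closed_conj_epi convex_conj_epi h'(2) near _ order_refl]) (use \<open>K \<ge> 0\<close> in simp)
  also have "\<dots> \<le> real DIM('a \<times> real) * (10 * (K + norm (a - b)))"
  proof (rule mult_left_mono)
    have "sqrt 2 \<le> 1.5" by (rule real_le_lsqrt) (auto simp: power2_eq_square)
    then have "sqrt 2 * K \<le> 1.5 * K" using \<open>K \<ge> 0\<close> by (rule mult_right_mono)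
    moreover have "0 \<le> norm (a - b)" by simp
    ultimately show "6.2 * (sqrt 2 * K + norm (a - b)) \<le> 10 * (K + norm (a - b))"
      using \<open>K \<ge> 0\<close> by argo
  qed simp
  finally show ?thesis by (simp add: algebra_simps)
qed

text \<open>Stated for an arbitrary filter so that it serves both joint continuity and the
  measurability argument.\<close>

lemma tendsto_epi_select:
  fixes h :: "'i \<Rightarrow> 'a::euclidean_space \<Rightarrow> real"
  assumes g: "convex_on UNIV g" "conj_epi g \<noteq> {}"
    and h: "\<forall>\<^sub>F i in F. convex_on UNIV (h i) \<and> conj_epi (h i) \<noteq> {}"
    and lim: "\<And>R. uniform_limit (cball 0 R) h g F" and a: "(a \<longlongrightarrow> b) F"
  shows "((\<lambda>i. epi_select (h i) (a i)) \<longlongrightarrow> epi_select g b) F"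
proof (rule tendstoI)
  fix \<epsilon> :: real assume \<epsilon>: "\<epsilon> > 0"
  define N where "N = real DIM('a \<times> real)"
  have N: "N > 0" by (simp add: N_def)
  \<comment> \<open>Both the sets and the base points will be \<theta>-close, giving an error
    \<open>N * (6.2 * (2 * \<theta>))\<close>, below \<open>N * (13 * \<theta>)\<close>. The cap at
    1 bounds the slack in \<rho> by 6.\<close>
  define \<theta> where "\<theta> = min 1 (\<epsilon> / (13 * N))"
  have \<theta>: "0 < \<theta>" "\<theta> \<le> 1" using \<epsilon> N by (auto simp: \<theta>_def)
  have "\<theta> \<le> \<epsilon> / (13 * N)" by (simp add: \<theta>_def)
  then have \<theta>\<epsilon>: "N * (13 * \<theta>) \<le> \<epsilon>" using N by (simp add: field_simps)
  define \<rho> where "\<rho> = norm b + 2 * infdist b (conj_epi g) + 6"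
  define M where "M = \<bar>g 0\<bar> + \<rho> + 2"
  have "\<rho> \<ge> 0" using infdist_nonneg[of b "conj_epi g"] by (simp add: \<rho>_def)
  then have M: "M > 0" by (simp add: M_def)
  \<comment> \<open>This radius makes the slope error \<open>M / R\<close> equal to half of
    \<theta>; the other half is the uniform error on the ball.\<close>
  define R where "R = 2 * M / \<theta>"
  have R: "R > 0" "M / R + \<theta> / 2 = \<theta>" using M \<theta> by (auto simp: R_def)
  have "\<forall>\<^sub>F i in F. \<forall>p\<in>cball 0 R. dist (h i p) (g p) < \<theta> / 2"
    using uniform_limitD[OF lim, of "\<theta> / 2" R] \<theta>(1) by simp
  moreover have "\<forall>\<^sub>F i in F. dist (a i) b < \<theta>"
    using a \<theta>(1) by (auto simp: tendsto_iff)
  ultimately show "\<forall>\<^sub>F i in F. dist (epi_select (h i) (a i)) (epi_select g b) < \<epsilon>"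
    using h
  proof eventually_elim
    case (elim i)
    have close: "\<bar>h i p - g p\<bar> \<le> \<theta> / 2" if "norm p \<le> R" for p
      using elim(1) that by (force simp: dist_real_def)
    then have close': "\<bar>g p - h i p\<bar> \<le> \<theta> / 2" if "norm p \<le> R" for p
      using that by (simp add: abs_minus_commute)
    have "\<bar>h i 0 - g 0\<bar> \<le> \<theta> / 2" using close[of 0] R(1) by simp
    then have "\<bar>h i 0\<bar> + \<rho> + \<theta> / 2 \<le> M" "\<bar>g 0\<bar> + \<rho> + \<theta> / 2 \<le> M"
      using \<theta> unfolding M_def by linarith+
    then have near: "local_near \<rho> (M / R + \<theta> / 2) (conj_epi g) (conj_epi (h i))"
        "local_near \<rho> (M / R + \<theta> / 2) (conj_epi (h i)) (conj_epi g)"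
      using elim(3) g(1) \<theta> R(1) by (auto intro!: local_near_conj_epi_local close close')
    note near = near[unfolded R(2)]
    have ab: "norm (b - a i) \<le> \<theta>" using elim(2) by (simp add: dist_norm norm_minus_commute)
    have "norm (epi_select g b - epi_select (h i) (a i))
        \<le> real DIM('a \<times> real) * (6.2 * (\<theta> + norm (b - a i)))"
      unfolding epi_select_def
    proof (rule proj_select_local_lipschitz[OF closed_conj_epi convex_conj_epi g(2)
          closed_conj_epi convex_conj_epi _ near])
      show "norm b + 2 * infdist b (conj_epi g) + 3 * (\<theta> + norm (b - a i)) \<le> \<rho>"
        using ab \<theta> unfolding \<rho>_def by argo
    qed (use elim(3) \<theta> in auto)
    also have "\<dots> < N * (13 * \<theta>)"
      unfolding N_def[symmetric] using ab N \<theta> by (intro mult_strict_left_mono) (argo, simp)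
    also have "\<dots> \<le> \<epsilon>" by (rule \<theta>\<epsilon>)
    finally show ?case by (simp add: dist_norm norm_minus_commute)
  qed
qed

text \<open>By compactness of balls, joint continuity gives uniform closeness of \<open>h s\<close>
  on each ball as \<open>s\<close> varies, which is the convergence required by
  \<open>tendsto_epi_select\<close>.\<close>

lemma continuous_on_epi_select:
  fixes h :: "'s::metric_space \<Rightarrow> 'a::euclidean_space \<Rightarrow> real"
  assumes cont: "continuous_on (S \<times> UNIV) (\<lambda>(s, p). h s p)"
    and h: "\<And>s. s \<in> S \<Longrightarrow> convex_on UNIV (h s)" "\<And>s. s \<in> S \<Longrightarrow> conj_epi (h s) \<noteq> {}"
  shows "continuous_on (S \<times> UNIV) (\<lambda>(s, a). epi_select (h s) a)"
  unfolding continuous_on_def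
proof
  fix z0 :: "'s \<times> 'a \<times> real" assume z0: "z0 \<in> S \<times> UNIV"
  let ?F = "at z0 within S \<times> UNIV"
  have in_S: "\<forall>\<^sub>F z in ?F. fst z \<in> S"
    by (simp add: eventually_at_filter always_eventually mem_Times_iff)
  have "((\<lambda>z. epi_select (h (fst z)) (snd z)) \<longlongrightarrow> epi_select (h (fst z0)) (snd z0)) ?F"
  proof (rule tendsto_epi_select)
    show "convex_on UNIV (h (fst z0))" "conj_epi (h (fst z0)) \<noteq> {}" using h z0 by auto
    show "\<forall>\<^sub>F z in ?F. convex_on UNIV (h (fst z)) \<and> conj_epi (h (fst z)) \<noteq> {}"
      using in_S by eventually_elim (use h in auto)
    show "(snd \<longlongrightarrow> snd z0) ?F" by (intro tendsto_intros)
    show "uniform_limit (cball 0 R) (\<lambda>z. h (fst z)) (h (fst z0)) ?F" for R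
      unfolding uniform_limit_iff
    proof (intro allI impI)
      fix e :: real assume e: "e > 0"
      have "continuous_on (S \<times> cball 0 R) (\<lambda>(s, p). h s p)"
        by (rule continuous_on_subset[OF cont]) auto
      moreover have "fst z0 \<in> S" "e / 2 > 0" using z0 e by auto
      ultimately obtain X where X: "fst z0 \<in> X" "open X"
          "\<forall>s\<in>X \<inter> S. \<forall>p\<in>cball 0 R. dist (h s p) (h (fst z0) p) \<le> e / 2"
        using continuous_on_prod_compactE[OF _ compact_cball, of S 0 R "\<lambda>(s, p). h s p" "fst z0" "e / 2"]
        by (simp only: prod.case) blast
      have "\<forall>\<^sub>F z in ?F. fst z \<in> X"
        using X(1,2) by (intro topological_tendstoD[OF tendsto_fst[OF tendsto_ident_at]]) auto
      with in_S show "\<forall>\<^sub>F z in ?F. \<forall>p\<in>cball 0 R. dist (h (fst z) p) (h (fst z0) p) < e"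
        by eventually_elim (use X(3) e in force)
    qed
  qed
  then show "((\<lambda>(s, a). epi_select (h s) a) \<longlongrightarrow> (case z0 of (s, a) \<Rightarrow> epi_select (h s) a)) ?F"
    by (simp add: case_prod_unfold)
qed

text \<open>The selection factors through countably many real data: the Lipschitz constant and the
  values of \<open>h t\<close> on a dense sequence. These data are measurable in \<open>t\<close>,
  and the selection is continuous on their range \<open>S\<close>; relative continuity suffices,
  whether or not \<open>S\<close> is a Borel set.\<close>

lemma borel_measurable_epi_select:
  fixes h :: "'t \<Rightarrow> 'a::euclidean_space \<Rightarrow> real"
  assumes h: "\<And>p. (\<lambda>t. h t p) \<in> borel_measurable M"
    and convex: "\<And>t. t \<in> space M \<Longrightarrow> convex_on UNIV (h t)"
    and ne: "\<And>t. t \<in> space M \<Longrightarrow> conj_epi (h t) \<noteq> {}"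
    and c: "c \<in> borel_measurable M" "\<And>t. t \<in> space M \<Longrightarrow> c t \<ge> 0"
    and lip: "\<And>t p q. t \<in> space M \<Longrightarrow> \<bar>h t p - h t q\<bar> \<le> c t * norm (p - q)"
  shows "(\<lambda>t. epi_select (h t) a) \<in> borel_measurable M"
proof -
  obtain D :: "'a set" where D: "countable D" "\<And>X. open X \<Longrightarrow> X \<noteq> {} \<Longrightarrow> \<exists>d\<in>D. d \<in> X"
    by (rule countable_dense_setE) blast
  then have "D \<noteq> {}" using D(2)[of UNIV] by auto
  define d where "d = from_nat_into D"
  have dense: "\<exists>i. norm (p - d i) < r" if "r > 0" for p r
  proof -
    have "ball p r \<noteq> {}" using that by simp
    then obtain x where "x \<in> D" "x \<in> ball p r" using D(2)[OF open_ball] by blast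
    moreover from \<open>x \<in> D\<close> obtain i where "d i = x"
      using from_nat_into_surj[OF D(1)] by (auto simp: d_def)
    ultimately show ?thesis by (auto simp: dist_norm)
  qed
  \<comment> \<open>Recording \<open>c t\<close> makes the Lipschitz constants bounded near each
    data point, which turns convergence on the dense sequence into locally uniform
    convergence.\<close>
  define \<phi> where "\<phi> t = (c t, \<lambda>i. h t (d i))" for t
  define S where "S = \<phi> ` space M"
  define \<psi> where "\<psi> = inv_into (space M) \<phi>"
  have \<psi>: "\<psi> z \<in> space M" "\<phi> (\<psi> z) = z" if "z \<in> S" for z
    using that by (auto simp: \<psi>_def S_def inv_into_into f_inv_into_f)
  have est: "\<bar>h t p - h s p\<bar> < e"
    if ts: "t \<in> space M" "s \<in> space M" and "e > 0" "c t < C" "c s < C"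
      and p: "norm (p - d i) < e / (3 * C)" and i: "\<bar>h t (d i) - h s (d i)\<bar> < e / 3" for t s p e C i
  proof -
    have C: "C > 0" using c(2)[OF ts(1)] that by linarith
    have "c u * norm (p - d i) \<le> e / 3" if "c u < C" for u
    proof -
      have "c u * norm (p - d i) \<le> C * (e / (3 * C))"
        using that p C by (intro mult_mono) auto
      then show ?thesis using C by simp
    qed
    then have "\<bar>h t p - h t (d i)\<bar> \<le> e / 3" "\<bar>h s p - h s (d i)\<bar> \<le> e / 3"
      using lip[OF ts(1), of p "d i"] lip[OF ts(2), of p "d i"] \<open>c t < C\<close> \<open>c s < C\<close> order_trans by blast+
    then show ?thesis using i by linarith
  qed
  \<comment> \<open>The data determine the function, so replacing \<open>t\<close> by the
    representative \<open>\<psi> (\<phi> t)\<close> does not change the selection.\<close>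
  have inj: "h t = h s" if ts: "t \<in> space M" "s \<in> space M" and eq: "\<phi> t = \<phi> s" for t s
  proof
    fix p
    have "\<bar>h t p - h s p\<bar> < e" if "e > 0" for e
    proof -
      have "e / (3 * (c t + 1)) > 0" using c(2)[OF ts(1)] that by simp
      then obtain i where "norm (p - d i) < e / (3 * (c t + 1))" using dense by blast
      then show ?thesis
        by (rule est[OF ts \<open>e > 0\<close>, rotated 2])
           (use eq that in \<open>auto simp: \<phi>_def fun_eq_iff\<close>)
    qed
    then have "\<bar>h t p - h s p\<bar> \<le> 0" by (meson less_irrefl not_le)
    then show "h t p = h s p" by simp
  qed
  have "continuous_on S (\<lambda>z. epi_select (h (\<psi> z)) a)"
    unfolding continuous_on_def
  proof
    fix z0 assume z0: "z0 \<in> S"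
    let ?F = "at z0 within S"
    have in_S: "\<forall>\<^sub>F z in ?F. z \<in> S" by (simp add: eventually_at_filter)
    show "((\<lambda>z. epi_select (h (\<psi> z)) a) \<longlongrightarrow> epi_select (h (\<psi> z0)) a) ?F"
    proof (rule tendsto_epi_select)
      show "convex_on UNIV (h (\<psi> z0))" "conj_epi (h (\<psi> z0)) \<noteq> {}"
        using convex ne \<psi>(1)[OF z0] by auto
      show "\<forall>\<^sub>F z in ?F. convex_on UNIV (h (\<psi> z)) \<and> conj_epi (h (\<psi> z)) \<noteq> {}"
        using in_S by eventually_elim (use convex ne \<psi>(1) in auto)
      show "((\<lambda>_. a) \<longlongrightarrow> a) ?F" by simp
      show "uniform_limit (cball 0 R) (\<lambda>z. h (\<psi> z)) (h (\<psi> z0)) ?F" for R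
        unfolding uniform_limit_iff
      proof (intro allI impI)
        fix e :: real assume e: "e > 0"
        define C where "C = fst z0 + 1"
        have c_eq: "c (\<psi> z) = fst z" and h_eq: "h (\<psi> z) (d i) = snd z i" if "z \<in> S" for z i
          using \<psi>(2)[OF that] by (auto simp: \<phi>_def prod_eq_iff fun_eq_iff)
        have C: "C > 0" using c(2)[OF \<psi>(1)[OF z0]] c_eq[OF z0] by (simp add: C_def)
        have "p \<in> (\<Union>i\<in>UNIV. ball (d i) (e / (3 * C)))" for p
          using dense[of "e / (3 * C)" p] e C by (auto simp: dist_norm norm_minus_commute)
        then have cover: "cball 0 R \<subseteq> (\<Union>i\<in>UNIV. ball (d i) (e / (3 * C)))" by blast
        \<comment> \<open>Compactness leaves finitely many coordinates to control, which is what a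
          neighbourhood in the product topology provides.\<close>
        obtain I where "I \<subseteq> UNIV" and I: "finite I" "cball 0 R \<subseteq> (\<Union>i\<in>I. ball (d i) (e / (3 * C)))"
          by (rule compactE_image[OF compact_cball open_ball cover])
        have "\<forall>\<^sub>F z in ?F. fst z < C"
          by (rule order_tendstoD(2)[OF tendsto_fst[OF tendsto_ident_at]]) (simp add: C_def)
        moreover have "\<forall>\<^sub>F z in ?F. \<forall>i\<in>I. dist (snd z i) (snd z0 i) < e / 3"
        proof (rule eventually_ball_finite[OF I(1)], rule ballI)
          fix i
          have "continuous_on UNIV (\<lambda>z::real \<times> (nat \<Rightarrow> real). snd z i)"
            by (rule continuous_on_product_then_coordinatewise[OF continuous_on_snd[OF continuous_on_id]])
          then have "((\<lambda>z. snd z i) \<longlongrightarrow> snd z0 i) (at z0)"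
            unfolding continuous_on_def by blast
          then have "((\<lambda>z. snd z i) \<longlongrightarrow> snd z0 i) ?F"
            by (rule tendsto_within_subset) simp
          then show "\<forall>\<^sub>F z in ?F. dist (snd z i) (snd z0 i) < e / 3"
            using e by (intro tendstoD) auto
        qed
        ultimately show "\<forall>\<^sub>F z in ?F. \<forall>p\<in>cball 0 R. dist (h (\<psi> z) p) (h (\<psi> z0) p) < e"
          using in_S
        proof eventually_elim
          case (elim z)
          show ?case
          proof
            fix p :: 'a assume "p \<in> cball 0 R"
            then obtain i where i: "i \<in> I" "norm (p - d i) < e / (3 * C)"
              using I(2) by (force simp: dist_norm norm_minus_commute)
            have "\<bar>h (\<psi> z) p - h (\<psi> z0) p\<bar> < e"
            proof (rule est[OF \<psi>(1)[OF elim(3)] \<psi>(1)[OF z0] e _ _ i(2)])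
              show "c (\<psi> z) < C" "c (\<psi> z0) < C"
                using elim(1) c_eq[OF elim(3)] c_eq[OF z0] by (auto simp: C_def)
              show "\<bar>h (\<psi> z) (d i) - h (\<psi> z0) (d i)\<bar> < e / 3"
                using elim(2) i(1) h_eq[OF elim(3)] h_eq[OF z0] by (simp add: dist_real_def)
            qed
            then show "dist (h (\<psi> z) p) (h (\<psi> z0) p) < e" by (simp add: dist_real_def)
          qed
        qed
      qed
    qed
  qed
  then have "(\<lambda>z. epi_select (h (\<psi> z)) a) \<in> borel_measurable (restrict_space borel S)"
    by (rule borel_measurable_continuous_on_restrict)
  moreover have "\<phi> \<in> measurable M (restrict_space borel S)"
  proof (rule measurable_restrict_space2)
    show "\<phi> \<in> space M \<rightarrow> S" by (auto simp: S_def)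
    have "(\<lambda>t i. h t (d i)) \<in> borel_measurable M"
      by (rule measurable_coordinatewise_then_product) (rule h)
    then show "\<phi> \<in> borel_measurable M"
      unfolding \<phi>_def by (rule borel_measurable_Pair[OF c(1)])
  qed
  ultimately have "(\<lambda>t. epi_select (h (\<psi> (\<phi> t))) a) \<in> borel_measurable M"
    by (rule measurable_compose[rotated])
  moreover have "h (\<psi> (\<phi> t)) = h t" if "t \<in> space M" for t
    using that \<psi>[of "\<phi> t"] by (intro inj) (auto simp: S_def)
  ultimately show ?thesis
    by (subst measurable_cong[where g="\<lambda>t. epi_select (h (\<psi> (\<phi> t))) a"]) auto
qed

section \<open>The parametrization of H and its properties\<close>

theorem theorem4p1:
  fixes H :: "real \<Rightarrow> real ^ 'n \<Rightarrow> real ^ 'n \<Rightarrow> real"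
    and c :: "real \<Rightarrow> real"
    and k :: "real \<Rightarrow> real \<Rightarrow> real"
    and T :: real
  assumes T_pos: "T > 0"
    and H1: "\<And>x p. (\<lambda>t. H t x p) measurable_on {0..T}"
    and H2: "\<And>t. t \<in> {0..T} \<Longrightarrow> continuous_on UNIV (\<lambda>(x, p). H t x p)"
    and H3: "\<And>t x. t \<in> {0..T} \<Longrightarrow> convex_on UNIV (H t x)"
    and H4_meas: "c measurable_on {0..T}"
    and H4_nonneg: "\<And>t. t \<in> {0..T} \<Longrightarrow> c t \<ge> 0"
    and H4: "\<And>t x p q. t \<in> {0..T} \<Longrightarrow>
               \<bar>H t x p - H t x q\<bar> \<le> c t * (1 + norm x) * norm (p - q)"
    and HLC_meas: "\<And>R. R > 0 \<Longrightarrow> k R measurable_on {0..T}"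
    and HLC_nonneg: "\<And>R t. R > 0 \<Longrightarrow> t \<in> {0..T} \<Longrightarrow> k R t \<ge> 0"
    and HLC: "\<And>R t x y p. R > 0 \<Longrightarrow> t \<in> {0..T} \<Longrightarrow> x \<in> cball 0 R \<Longrightarrow> y \<in> cball 0 R \<Longrightarrow>
               \<bar>H t x p - H t y p\<bar> \<le> k R t * (1 + norm p) * norm (x - y)"
  shows "\<exists>(f :: real \<Rightarrow> real ^ 'n \<Rightarrow> ((real ^ 'n) \<times> real) \<Rightarrow> real ^ 'n)
           (l :: real \<Rightarrow> real ^ 'n \<Rightarrow> ((real ^ 'n) \<times> real) \<Rightarrow> real).
      (\<forall>x a. (\<lambda>t. f t x a) measurable_on {0..T}) \<and>
      (\<forall>x a. (\<lambda>t. l t x a) measurable_on {0..T}) \<and>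
      (\<forall>t\<in>{0..T}. continuous_on UNIV (\<lambda>(x, a). f t x a)) \<and>
      (\<forall>t\<in>{0..T}. continuous_on UNIV (\<lambda>(x, a). l t x a)) \<and>
      (\<forall>t\<in>{0..T}. \<forall>x p. ereal (H t x p) = (SUP a. ereal (inner p (f t x a) - l t x a))) \<and>
      (\<forall>t\<in>{0..T}. \<forall>x. range (f t x) = Hconj_dom H t x) \<and>
      (\<forall>R>0. \<forall>t\<in>{0..T}. \<forall>x\<in>cball 0 R. \<forall>y\<in>cball 0 R. \<forall>a b.
          norm (f t x a - f t y b) \<le> 10 * (real CARD('n) + 1) * (k R t * norm (x - y) + norm (a - b)) \<and>
          \<bar>l t x a - l t y b\<bar> \<le> 10 * (real CARD('n) + 1) * (k R t * norm (x - y) + norm (a - b))) \<and>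
      (\<forall>t\<in>{0..T}. \<forall>x a. norm (f t x a) \<le> c t * (1 + norm x) \<and>
          - \<bar>H t x 0\<bar> \<le> l t x a \<and>
          l t x a \<le> 2 * \<bar>H t x 0\<bar> + 2 * c t * (1 + norm x) + 3 * norm a) \<and>
      (\<forall>t\<in>{0..T}. \<forall>x. \<forall>a\<in>Hconj_epi H t x. a = (f t x a, l t x a)) \<and>
      (continuous_on ({0..T} \<times> UNIV \<times> UNIV) (\<lambda>(t, x, p). H t x p) \<longrightarrow>
          continuous_on ({0..T} \<times> UNIV \<times> UNIV) (\<lambda>(t, x, a). f t x a) \<and>
          continuous_on ({0..T} \<times> UNIV \<times> UNIV) (\<lambda>(t, x, a). l t x a))"
proof -
  define f where "f t x a = fst (epi_select (H t x) a)" for t x and a :: "(real ^ 'n) \<times> real"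
  define l where "l t x a = snd (epi_select (H t x) a)" for t x and a :: "(real ^ 'n) \<times> real"
  define L where "L t x = c t * (1 + norm x)" for t and x :: "real ^ 'n"
  have fl: "epi_select (H t x) a = (f t x a, l t x a)" for t x a
    by (simp add: f_def l_def)
  have L: "L t x \<ge> 0" "\<And>p q. \<bar>H t x p - H t x q\<bar> \<le> L t x * norm (p - q)"
    if "t \<in> {0..T}" for t x
    using H4_nonneg[OF that] H4[OF that] by (auto simp: L_def)
  have ne: "conj_epi (H t x) \<noteq> {}" if "t \<in> {0..T}" for t x
    using conj_epi_subgradient[OF H3[OF that] L(2)[OF that] L(1)[OF that]] by blast
  have in_epi: "(f t x a, l t x a) \<in> conj_epi (H t x)" if "t \<in> {0..T}" for t x a
    unfolding fl[symmetric] by (rule epi_select_in[OF ne[OF that]])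
  have of_mem: "(f t x a, l t x a) = a" if "a \<in> conj_epi (H t x)" for t x a
    unfolding fl[symmetric] by (rule epi_select_of_mem[OF that])

  have sel_meas: "(\<lambda>t. epi_select (H t x) a) \<in> borel_measurable (lebesgue_on {0..T})" for x a
  proof (rule borel_measurable_epi_select)
    show "(\<lambda>t. H t x p) \<in> borel_measurable (lebesgue_on {0..T})" for p
      using H1[of x p] by (simp add: measurable_on_iff_borel_measurable)
    have "c \<in> borel_measurable (lebesgue_on {0..T})"
      using H4_meas by (simp add: measurable_on_iff_borel_measurable)
    then show "(\<lambda>t. L t x) \<in> borel_measurable (lebesgue_on {0..T})"
      unfolding L_def by measurable
  qed (use H3 ne L in auto)
  have meas: "\<forall>x a. (\<lambda>t. f t x a) measurable_on {0..T}" "\<forall>x a. (\<lambda>t. l t x a) measurable_on {0..T}"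
    using measurable_compose[OF sel_meas borel_measurable_continuous_onI[OF continuous_on_fst[OF continuous_on_id]]]
      measurable_compose[OF sel_meas borel_measurable_continuous_onI[OF continuous_on_snd[OF continuous_on_id]]]
    by (simp_all add: f_def l_def measurable_on_iff_borel_measurable)

  have cont: "\<forall>t\<in>{0..T}. continuous_on UNIV (\<lambda>(x, a). f t x a)"
    "\<forall>t\<in>{0..T}. continuous_on UNIV (\<lambda>(x, a). l t x a)"
  proof -
    have "continuous_on UNIV (\<lambda>(x, a). epi_select (H t x) a)" if "t \<in> {0..T}" for t
      using continuous_on_epi_select[of UNIV "H t"] H2[OF that] H3[OF that] ne[OF that] by simp
    then show "\<forall>t\<in>{0..T}. continuous_on UNIV (\<lambda>(x, a). f t x a)"
      "\<forall>t\<in>{0..T}. continuous_on UNIV (\<lambda>(x, a). l t x a)"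
      unfolding f_def l_def case_prod_unfold by (auto intro: continuous_on_fst continuous_on_snd)
  qed

  have cont_joint: "continuous_on ({0..T} \<times> UNIV \<times> UNIV) (\<lambda>(t, x, a). f t x a) \<and>
      continuous_on ({0..T} \<times> UNIV \<times> UNIV) (\<lambda>(t, x, a). l t x a)"
    if "continuous_on ({0..T} \<times> UNIV \<times> UNIV) (\<lambda>(t, x, p). H t x p)"
  proof -
    \<comment> \<open>Time and state are grouped into one parameter so that the general continuity
      lemma applies; the grouping is undone afterwards.\<close>
    have "continuous_on (({0..T} \<times> UNIV) \<times> UNIV) (\<lambda>z. case (fst (fst z), snd (fst z), snd z) of (t, x, p) \<Rightarrow> H t x p)"
      by (rule continuous_on_compose2[OF that]) (auto intro!: continuous_intros)
    then have "continuous_on (({0..T} \<times> UNIV) \<times> UNIV) (\<lambda>(s, p). H (fst s) (snd s) p)"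
      by (simp add: case_prod_unfold)
    then have "continuous_on (({0..T} \<times> UNIV) \<times> UNIV) (\<lambda>(s, a). epi_select (H (fst s) (snd s)) a)"
      by (rule continuous_on_epi_select) (use H3 ne in auto)
    then have "continuous_on ({0..T} \<times> UNIV \<times> UNIV)
        (\<lambda>z. case ((fst z, fst (snd z)), snd (snd z)) of (s, a) \<Rightarrow> epi_select (H (fst s) (snd s)) a)"
      by (rule continuous_on_compose2) (auto intro!: continuous_intros)
    then have "continuous_on ({0..T} \<times> UNIV \<times> UNIV) (\<lambda>z. epi_select (H (fst z) (fst (snd z))) (snd (snd z)))"
      by simp
    then show ?thesis
      unfolding f_def l_def case_prod_unfold by (auto intro: continuous_on_fst continuous_on_snd)
  qed

  have sup: "ereal (H t x p) = (SUP a. ereal (inner p (f t x a) - l t x a))" if t: "t \<in> {0..T}" for t x p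
  proof (rule antisym)
    \<comment> \<open>The affine minorant touching \<open>H t x\<close> at \<open>p\<close> is
      itself a parameter fixed by the selection, so the supremum is attained there.\<close>
    obtain v where v: "(v, inner v p - H t x p) \<in> conj_epi (H t x)"
      using conj_epi_subgradient[OF H3[OF t] L(2)[OF t] L(1)[OF t]] by blast
    have "ereal (H t x p) = ereal (inner p (f t x (v, inner v p - H t x p)) - l t x (v, inner v p - H t x p))"
      using of_mem[OF v] by (simp add: inner_commute)
    also have "\<dots> \<le> (SUP a. ereal (inner p (f t x a) - l t x a))"
      by (rule SUP_upper) simp
    finally show "ereal (H t x p) \<le> (SUP a. ereal (inner p (f t x a) - l t x a))" .
    show "(SUP a. ereal (inner p (f t x a) - l t x a)) \<le> ereal (H t x p)"
      using in_epi[OF t, of x] by (intro SUP_least) (simp add: inner_commute)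
  qed

  have dom: "range (f t x) = Hconj_dom H t x" if t: "t \<in> {0..T}" for t x
  proof
    show "range (f t x) \<subseteq> Hconj_dom H t x"
      unfolding Hconj_dom_eq using in_epi[OF t, of x] by (auto intro!: rev_image_eqI simp del: mem_conj_epi)
    show "Hconj_dom H t x \<subseteq> range (f t x)"
      unfolding Hconj_dom_eq using of_mem[of _ t x] by (metis fst_conv image_subsetI rangeI)
  qed

  have A1: "norm (f t x a - f t y b) \<le> 10 * (real CARD('n) + 1) * (k R t * norm (x - y) + norm (a - b)) \<and>
      \<bar>l t x a - l t y b\<bar> \<le> 10 * (real CARD('n) + 1) * (k R t * norm (x - y) + norm (a - b))"
    if R: "R > 0" and t: "t \<in> {0..T}" and xy: "x \<in> cball 0 R" "y \<in> cball 0 R" for R t x y a b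
  proof -
    have "norm (epi_select (H t x) a - epi_select (H t y) b)
        \<le> 10 * (real DIM(real ^ 'n) + 1) * (k R t * norm (x - y) + norm (a - b))"
    proof (rule epi_select_lipschitz)
      show "\<bar>H t x p - H t y p\<bar> \<le> k R t * norm (x - y) * (1 + norm p)" for p
        using HLC[OF R t xy, of p] by (simp add: mult_ac)
    qed (use H3[OF t] ne[OF t] HLC_nonneg[OF R t] in auto)
    moreover have "norm (f t x a - f t y b) \<le> norm (epi_select (H t x) a - epi_select (H t y) b)"
      "\<bar>l t x a - l t y b\<bar> \<le> norm (epi_select (H t x) a - epi_select (H t y) b)"
      unfolding fl by (simp_all add: norm_fst_le norm_snd_le[where 'a=real, simplified])
    ultimately show ?thesis by simp
  qed

  have A2: "norm (f t x a) \<le> c t * (1 + norm x) \<and> - \<bar>H t x 0\<bar> \<le> l t x a \<and>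
      l t x a \<le> 2 * \<bar>H t x 0\<bar> + 2 * c t * (1 + norm x) + 3 * norm a"
    if t: "t \<in> {0..T}" for t x a
  proof -
    note bounds = conj_epi_bounds[OF L(2)[OF t] L(1)[OF t]]
    have lower: "norm (f t x a) \<le> L t x" "l t x a \<ge> - H t x 0"
      using bounds[OF in_epi[OF t]] by auto
    obtain v where "(v, inner v 0 - H t x 0) \<in> conj_epi (H t x)"
      using conj_epi_subgradient[OF H3[OF t] L(2)[OF t] L(1)[OF t]] by blast
    then have v: "(v, - H t x 0) \<in> conj_epi (H t x)" by simp
    \<comment> \<open>The subgradient at \<open>0\<close> gives a point of the epigraph of
      explicitly bounded norm. Comparison with it gives \<open>norm a + 2 * norm (a - z)\<close>,
      the source of the constants 2 and 3 in the upper bound.\<close>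
    define z where "z = (v, - H t x 0)"
    have z: "norm z \<le> L t x + \<bar>H t x 0\<bar>"
      using norm_Pair_le[of v "- H t x 0"] bounds(1)[OF v] by (simp add: z_def)
    have "\<bar>l t x a\<bar> \<le> norm (epi_select (H t x) a)"
      using norm_snd_le[of "l t x a" "f t x a"] by (simp add: fl)
    also have "\<dots> \<le> norm a + norm (epi_select (H t x) a - a)"
      using norm_triangle_ineq[of a "epi_select (H t x) a - a"] by simp
    also have "\<dots> \<le> norm a + 2 * norm (a - z)"
      using dist_epi_select_le[OF v, of a] by (simp add: z_def)
    also have "\<dots> \<le> norm a + 2 * (norm a + (L t x + \<bar>H t x 0\<bar>))"
      using norm_triangle_ineq4[of a z] z by simp
    finally have "l t x a \<le> 2 * \<bar>H t x 0\<bar> + 2 * L t x + 3 * norm a" by simp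
    then show ?thesis using lower by (auto simp: L_def mult.assoc)
  qed

  have A3: "a = (f t x a, l t x a)" if "a \<in> Hconj_epi H t x" for t x a
    using of_mem[of a t x] that by (simp add: Hconj_epi_eq)

  show ?thesis
    by (intro exI[of _ f] exI[of _ l] conjI)
       (rule meas cont | (intro ballI allI impI; rule sup dom A1 A2 A3 cont_joint; assumption))+
qed

end
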